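(* Assume that $f^{-1}$ commutes with joins of subobjects for every morphism $f$ of $\mathcal{C}$. Let $(G,\varepsilon)$ be an $\mathcal{M}$-copointed endofunctor of $\mathcal{C}$ and let $\mathcal{S}$ be a co-perfect syntopogenous structure on $\mathcal{C}$ with respect to $\mathcal{M}$, with associated quasi-uniformity $\mathcal{V}=\mathcal{U}^{\mathcal{S}}$. For $X\in\mathcal{C}$ put $$\mathcal{B}^{\mathcal{S}^{G,\varepsilon}}_X=\{V^{\sqsubset^{G,\varepsilon}}\;|\;V^{\sqsubset}\in\mathcal{B}^{\mathcal{S}}_{GX}\},\qquad V^{\sqsubset^{G,\varepsilon}}(m)=m\vee\varepsilon_X\big(V^{\sqsubset}(\varepsilon_X^{-1}(m))\big)\quad(m\in\mathrm{sub}X).$$ Then $\mathcal{B}^{\mathcal{S}^{G,\varepsilon}}$ is a base for the finest quasi-uniformity $\mathcal{V}^{G,\varepsilon}$ on $\mathcal{C}$ which makes every $\varepsilon_X:GX\to X$ $(\mathcal{V},\mathcal{V}^{G,\varepsilon})$-continuous.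
   Context: $\mathcal{C}$ is a category with a proper $(\mathcal{E},\mathcal{M})$-factorization system for morphisms ($\mathcal{E}$ consists of epimorphisms, $\mathcal{M}$ of monomorphisms), and it is $\mathcal{M}$-complete: pullbacks of $\mathcal{M}$-morphisms along arbitrary morphisms and arbitrary $\mathcal{M}$-intersections exist and are again in $\mathcal{M}$. The class $\mathcal{E}$ is stable under pullbacks along $\mathcal{M}$-morphisms. For $X\in\mathcal{C}$, $\mathrm{sub}X=\{m\in\mathcal{M}\mid \mathrm{cod}(m)=X\}$, ordered by $n\le m$ iff $m\circ j=n$ for some $j$; isomorphic subobjects are identified, so $\mathrm{sub}X$ is a (possibly large) complete lattice. For $f:X\to Y$, $f(m)$ is the $\mathcal{M}$-component of the factorization of $f\circ m$ and $f^{-1}(n)$ is the pullback of $n$ along $f$. A copointed endofunctor $(G,\varepsilon)$ is a functor $G:\mathcal{C}\to\mathcal{C}$ with a natural transformation $\varepsilon:G\to1_{\mathcal{C}}$; it is $\mathcal{M}$-copointed if every $\varepsilon_X\in\mathcal{M}$. A topogenous order on $\mathcal{C}$ is a family of relations $\sqsubset_X$ on $\mathrm{sub}X$ ($X\in\mathcal{C}$) with (T1) $m\sqsubset_X n\Rightarrow m\le n$; (T2) $m\le n\sqsubset_X p\le q\Rightarrow m\sqsubset_X q$; (T3) for every $f:X\to Y$, $m\sqsubset_Y n\Rightarrow f^{-1}(m)\sqsubset_X f^{-1}(n)$. A relation is $\bigwedge$-preserving if ($m\sqsubset_X n_i$ for all $i\in I$) implies $m\sqsubset_X\bigwedge n_i$,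 and interpolates if $m\sqsubset_X n$ implies $m\sqsubset_X p\sqsubset_X n$ for some $p$. A syntopogenous structure on $\mathcal{C}$ is a family $\mathcal{S}=\{\mathcal{S}_X\}$ of sets of relations on $\mathrm{sub}X$ such that (S1) each $\sqsubset_X\in\mathcal{S}_X$ satisfies (T1), (T2); (S2) $\mathcal{S}_X$ is directed under inclusion; (S3) the relations $\bigcup\mathcal{S}_X$ form an interpolative topogenous order. It is co-perfect if every $\sqsubset_X\in\mathcal{S}_X$ is $\bigwedge$-preserving. A quasi-uniformity on $\mathcal{C}$ with respect to $\mathcal{M}$ is a family $\mathcal{U}=\{\mathcal{U}_X\mid X\in\mathcal{C}\}$, each $\mathcal{U}_X$ a collection of order-preserving maps $\mathrm{sub}X\to\mathrm{sub}X$ (ordered pointwise), such that (U1) $m\le U(m)$ for all $m$ and $U\in\mathcal{U}_X$; (U2) for $U\in\mathcal{U}_X$ there is $U'\in\mathcal{U}_X$ with $U'\circ U'\le U$; (U3) $U\in\mathcal{U}_X$, $U\le U'$ imply $U'\in\mathcal{U}_X$; (U4) $U,U'\in\mathcal{U}_X$ imply $U\wedge U'\in\mathcal{U}_X$; (U5) for $f:X\to Y$ and $U\in\mathcal{U}_Y$ there is $U'\in\mathcal{U}_X$ with $f(U'(m))\le U(f(m))$ for all $m\in\mathrm{sub}X$. A base is a family $\mathcal{B}=\{\mathcal{B}_X\}$ satisfying all of these except (U3); the quasi-uniformity it generates consists of all $V$ lying above some member of the base. Order: $\mathcal{U}\le\mathcal{V}$ iff for all $X$ and $U\in\mathcal{U}_X$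 there is $V\in\mathcal{V}_X$ with $V\le U$; "finest" means greatest. A morphism $f:X\to Y$ is $(\mathcal{U},\mathcal{U}')$-continuous if for any $U'\in\mathcal{U}'_Y$ there is $U\in\mathcal{U}_X$ with $f(U(m))\le U'(f(m))$ for all $m\in\mathrm{sub}X$. For co-perfect $\mathcal{S}$: $\mathcal{B}^{\mathcal{S}}_X=\{V^{\sqsubset}\mid\sqsubset_X\in\mathcal{S}_X\}$ with $V^{\sqsubset}(m)=\bigwedge\{n\mid m\sqsubset_X n\}$. Co-perfect syntopogenous structures are understood to be those corresponding to quasi-uniformities: $\mathcal{B}^{\mathcal{S}}$ is a base for a quasi-uniformity, denoted $\mathcal{U}^{\mathcal{S}}$. $\mathcal{V}^{G,\varepsilon}$ is the quasi-uniformity generated by $\mathcal{B}^{\mathcal{S}^{G,\varepsilon}}$. *)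

theory Defs
  imports "HOL-Algebra.Complete_Lattice"
begin

section \<open>Categories with a factorization system\<close>

text \<open>Composition is written in the usual order: \<open>g \<cdot> f\<close> is meaningful when
  \<open>Dom g = Cod f\<close>; its value on non-composable pairs is irrelevant.\<close>

record ('o, 'a) cat =
  Obj :: "'o set"
  Arr :: "'a set"
  Dom :: "'a \<Rightarrow> 'o"
  Cod :: "'a \<Rightarrow> 'o"
  Ident :: "'o \<Rightarrow> 'a"
  Comp :: "'a \<Rightarrow> 'a \<Rightarrow> 'a" (infixr \<open>\<cdot>\<index>\<close> 70)

record ('o, 'a) fact_cat = "('o, 'a) cat" +
  Ecls :: "'a set" (\<open>\<E>\<index>\<close>)
  Mcls :: "'a set" (\<open>\<M>\<index>\<close>)

locale category =
  fixes C :: "('o, 'a, 'z) cat_scheme" (structure)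
  assumes Dom_Obj: "f \<in> Arr C \<Longrightarrow> Dom C f \<in> Obj C"
    and Cod_Obj: "f \<in> Arr C \<Longrightarrow> Cod C f \<in> Obj C"
    and Ident_Arr: "X \<in> Obj C \<Longrightarrow> Ident C X \<in> Arr C"
    and Dom_Ident: "X \<in> Obj C \<Longrightarrow> Dom C (Ident C X) = X"
    and Cod_Ident: "X \<in> Obj C \<Longrightarrow> Cod C (Ident C X) = X"
    and Comp_Arr: "\<lbrakk>f \<in> Arr C; g \<in> Arr C; Dom C g = Cod C f\<rbrakk> \<Longrightarrow> g \<cdot> f \<in> Arr C"
    and Dom_Comp: "\<lbrakk>f \<in> Arr C; g \<in> Arr C; Dom C g = Cod C f\<rbrakk> \<Longrightarrow> Dom C (g \<cdot> f) = Dom C f"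
    and Cod_Comp: "\<lbrakk>f \<in> Arr C; g \<in> Arr C; Dom C g = Cod C f\<rbrakk> \<Longrightarrow> Cod C (g \<cdot> f) = Cod C g"
    and Comp_Ident: "f \<in> Arr C \<Longrightarrow> f \<cdot> Ident C (Dom C f) = f"
    and Ident_Comp: "f \<in> Arr C \<Longrightarrow> Ident C (Cod C f) \<cdot> f = f"
    and Comp_assoc: "\<lbrakk>f \<in> Arr C; g \<in> Arr C; h \<in> Arr C; Dom C g = Cod C f; Dom C h = Cod C g\<rbrakk>
      \<Longrightarrow> (h \<cdot> g) \<cdot> f = h \<cdot> (g \<cdot> f)"

definition Hom :: "('o, 'a, 'z) cat_scheme \<Rightarrow> 'o \<Rightarrow> 'o \<Rightarrow> 'a set" where
  "Hom C X Y = {f \<in> Arr C. Dom C f = X \<and> Cod C f = Y}"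

definition iso_arr :: "('o, 'a, 'z) cat_scheme \<Rightarrow> 'a \<Rightarrow> bool" where
  "iso_arr C f \<longleftrightarrow> f \<in> Arr C \<and>
    (\<exists>g \<in> Hom C (Cod C f) (Dom C f).
      g \<cdot>\<^bsub>C\<^esub> f = Ident C (Dom C f) \<and> f \<cdot>\<^bsub>C\<^esub> g = Ident C (Cod C f))"

definition mono_arr :: "('o, 'a, 'z) cat_scheme \<Rightarrow> 'a \<Rightarrow> bool" where
  "mono_arr C m \<longleftrightarrow> m \<in> Arr C \<and>
    (\<forall>Z \<in> Obj C. \<forall>g \<in> Hom C Z (Dom C m). \<forall>h \<in> Hom C Z (Dom C m).
      m \<cdot>\<^bsub>C\<^esub> g = m \<cdot>\<^bsub>C\<^esub> h \<longrightarrow> g = h)"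

definition epi_arr :: "('o, 'a, 'z) cat_scheme \<Rightarrow> 'a \<Rightarrow> bool" where
  "epi_arr C e \<longleftrightarrow> e \<in> Arr C \<and>
    (\<forall>Z \<in> Obj C. \<forall>g \<in> Hom C (Cod C e) Z. \<forall>h \<in> Hom C (Cod C e) Z.
      g \<cdot>\<^bsub>C\<^esub> e = h \<cdot>\<^bsub>C\<^esub> e \<longrightarrow> g = h)"

text \<open>\<open>is_pullback C f g p q\<close>: the square \<open>f \<cdot> p = g \<cdot> q\<close> is a pullback;
  \<open>p\<close> is the pullback of \<open>g\<close> along \<open>f\<close>, and \<open>q\<close> the pullback of \<open>f\<close> along \<open>g\<close>.\<close>

definition is_pullback :: "('o, 'a, 'z) cat_scheme \<Rightarrow> 'a \<Rightarrow> 'a \<Rightarrow> 'a \<Rightarrow> 'a \<Rightarrow> bool" where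
  "is_pullback C f g p q \<longleftrightarrow>
    f \<in> Arr C \<and> g \<in> Arr C \<and> Cod C f = Cod C g \<and>
    p \<in> Arr C \<and> Cod C p = Dom C f \<and> q \<in> Hom C (Dom C p) (Dom C g) \<and>
    f \<cdot>\<^bsub>C\<^esub> p = g \<cdot>\<^bsub>C\<^esub> q \<and>
    (\<forall>Z \<in> Obj C. \<forall>a \<in> Hom C Z (Dom C f). \<forall>b \<in> Hom C Z (Dom C g).
      f \<cdot>\<^bsub>C\<^esub> a = g \<cdot>\<^bsub>C\<^esub> b \<longrightarrow>
      (\<exists>!h. h \<in> Hom C Z (Dom C p) \<and> p \<cdot>\<^bsub>C\<^esub> h = a \<and> q \<cdot>\<^bsub>C\<^esub> h = b))"

text \<open>\<open>is_intersection C X A m\<close>: the arrow \<open>m\<close> is the intersection (multiple pullback) of the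
  set \<open>A\<close> of monomorphisms with codomain \<open>X\<close>. Since the members of \<open>A\<close> are monic,
  the projections of the multiple pullback are determined by \<open>m\<close>.\<close>

definition is_intersection :: "('o, 'a, 'z) cat_scheme \<Rightarrow> 'o \<Rightarrow> 'a set \<Rightarrow> 'a \<Rightarrow> bool" where
  "is_intersection C X A m \<longleftrightarrow>
    m \<in> Arr C \<and> Cod C m = X \<and>
    (\<forall>n \<in> A. \<exists>j \<in> Hom C (Dom C m) (Dom C n). n \<cdot>\<^bsub>C\<^esub> j = m) \<and>
    (\<forall>Z \<in> Obj C. \<forall>g \<in> Hom C Z X.
      (\<forall>n \<in> A. \<exists>j \<in> Hom C Z (Dom C n). n \<cdot>\<^bsub>C\<^esub> j = g) \<longrightarrow>
      (\<exists>!h. h \<in> Hom C Z (Dom C m) \<and> m \<cdot>\<^bsub>C\<^esub> h = g))"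

locale proper_factorization_system = category C
  for C :: "('o, 'a, 'z) fact_cat_scheme" (structure) +
  assumes E_epi: "e \<in> \<E> \<Longrightarrow> epi_arr C e"
    and M_mono: "m \<in> \<M> \<Longrightarrow> mono_arr C m"
    and iso_E: "iso_arr C i \<Longrightarrow> i \<in> \<E>"
    and iso_M: "iso_arr C i \<Longrightarrow> i \<in> \<M>"
    and E_Comp: "\<lbrakk>d \<in> \<E>; e \<in> \<E>; Dom C e = Cod C d\<rbrakk> \<Longrightarrow> e \<cdot> d \<in> \<E>"
    and M_Comp: "\<lbrakk>m \<in> \<M>; n \<in> \<M>; Dom C n = Cod C m\<rbrakk> \<Longrightarrow> n \<cdot> m \<in> \<M>"
    and factorization: "f \<in> Arr C \<Longrightarrow> \<exists>e \<in> \<E>. \<exists>m \<in> \<M>. Dom C m = Cod C e \<and> f = m \<cdot> e"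
    and diagonalization:
      "\<lbrakk>e \<in> \<E>; m \<in> \<M>; u \<in> Hom C (Dom C e) (Dom C m); v \<in> Hom C (Cod C e) (Cod C m);
        m \<cdot> u = v \<cdot> e\<rbrakk>
       \<Longrightarrow> \<exists>!w. w \<in> Hom C (Cod C e) (Dom C m) \<and> w \<cdot> e = u \<and> m \<cdot> w = v"

locale M_complete_category = proper_factorization_system C
  for C :: "('o, 'a, 'z) fact_cat_scheme" (structure) +
  assumes M_pullback_exists:
      "\<lbrakk>f \<in> Arr C; n \<in> \<M>; Cod C n = Cod C f\<rbrakk> \<Longrightarrow> \<exists>p q. is_pullback C f n p q"
    and M_pullback_stable: "\<lbrakk>n \<in> \<M>; is_pullback C f n p q\<rbrakk> \<Longrightarrow> p \<in> \<M>"
    and M_intersection_exists: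
      "\<lbrakk>X \<in> Obj C; A \<subseteq> {m \<in> \<M>. Cod C m = X}\<rbrakk> \<Longrightarrow> \<exists>m. is_intersection C X A m"
    and M_intersection_stable:
      "\<lbrakk>X \<in> Obj C; A \<subseteq> {m \<in> \<M>. Cod C m = X}; is_intersection C X A m\<rbrakk> \<Longrightarrow> m \<in> \<M>"
    and E_stable_along_M: "\<lbrakk>e \<in> \<E>; m \<in> \<M>; is_pullback C e m p q\<rbrakk> \<Longrightarrow> q \<in> \<E>"


section \<open>Subobjects\<close>

text \<open>A subobject is an isomorphism class of \<open>\<M>\<close>-morphisms.\<close>

definition sub_iso :: "('o, 'a, 'z) fact_cat_scheme \<Rightarrow> 'o \<Rightarrow> ('a \<times> 'a) set" where
  "sub_iso C X = {(m, n). m \<in> \<M>\<^bsub>C\<^esub> \<and> n \<in> \<M>\<^bsub>C\<^esub> \<and> Cod C m = X \<and> Cod C n = X \<and>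
    (\<exists>j \<in> Hom C (Dom C n) (Dom C m). iso_arr C j \<and> m \<cdot>\<^bsub>C\<^esub> j = n)}"

definition Sub :: "('o, 'a, 'z) fact_cat_scheme \<Rightarrow> 'o \<Rightarrow> 'a set gorder" where
  "Sub C X =
    \<lparr> carrier = {m \<in> \<M>\<^bsub>C\<^esub>. Cod C m = X} // sub_iso C X,
      eq = (=),
      le = (\<lambda>N M. \<exists>n \<in> N. \<exists>m \<in> M. \<exists>j \<in> Hom C (Dom C n) (Dom C m). m \<cdot>\<^bsub>C\<^esub> j = n) \<rparr>"

text \<open>The image \<open>f(M)\<close> of a class \<open>M\<close> collects all possible \<open>\<M>\<close>-components of
  \<open>(\<E>,\<M>)\<close>-factorizations of \<open>f \<cdot> m\<close> for representatives \<open>m\<close>; the preimage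
  collects all possible pullbacks of representatives. As both constructions are unique up to
  isomorphism, these sets are again isomorphism classes.\<close>

definition image_sub :: "('o, 'a, 'z) fact_cat_scheme \<Rightarrow> 'a \<Rightarrow> 'a set \<Rightarrow> 'a set" where
  "image_sub C f M = {n \<in> \<M>\<^bsub>C\<^esub>. \<exists>m \<in> M. \<exists>e \<in> \<E>\<^bsub>C\<^esub>.
    Dom C n = Cod C e \<and> f \<cdot>\<^bsub>C\<^esub> m = n \<cdot>\<^bsub>C\<^esub> e}"

definition preimage_sub :: "('o, 'a, 'z) fact_cat_scheme \<Rightarrow> 'a \<Rightarrow> 'a set \<Rightarrow> 'a set" where
  "preimage_sub C f N = {p. \<exists>n \<in> N. \<exists>q. is_pullback C f n p q}"

definition preimages_commute_with_joins :: "('o, 'a, 'z) fact_cat_scheme \<Rightarrow> bool" where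
  "preimages_commute_with_joins C \<longleftrightarrow>
    (\<forall>f \<in> Arr C. \<forall>A \<subseteq> carrier (Sub C (Cod C f)).
      preimage_sub C f (\<Squnion>\<^bsub>Sub C (Cod C f)\<^esub> A) = \<Squnion>\<^bsub>Sub C (Dom C f)\<^esub> (preimage_sub C f ` A))"


section \<open>Copointed endofunctors\<close>

locale endofunctor = category C
  for C :: "('o, 'a, 'z) cat_scheme" (structure) and Go :: "'o \<Rightarrow> 'o" and Ga :: "'a \<Rightarrow> 'a" +
  assumes functor_Obj: "X \<in> Obj C \<Longrightarrow> Go X \<in> Obj C"
    and functor_Arr: "f \<in> Arr C \<Longrightarrow> Ga f \<in> Hom C (Go (Dom C f)) (Go (Cod C f))"
    and functor_Ident: "X \<in> Obj C \<Longrightarrow> Ga (Ident C X) = Ident C (Go X)"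
    and functor_Comp: "\<lbrakk>f \<in> Arr C; g \<in> Arr C; Dom C g = Cod C f\<rbrakk> \<Longrightarrow> Ga (g \<cdot> f) = Ga g \<cdot> Ga f"

locale copointed_endofunctor = endofunctor C Go Ga
  for C :: "('o, 'a, 'z) cat_scheme" (structure) and Go :: "'o \<Rightarrow> 'o" and Ga :: "'a \<Rightarrow> 'a" +
  fixes \<epsilon> :: "'o \<Rightarrow> 'a"
  assumes counit_Hom: "X \<in> Obj C \<Longrightarrow> \<epsilon> X \<in> Hom C (Go X) X"
    and counit_natural: "f \<in> Arr C \<Longrightarrow> f \<cdot> \<epsilon> (Dom C f) = \<epsilon> (Cod C f) \<cdot> Ga f"

locale M_copointed_endofunctor = copointed_endofunctor C Go Ga \<epsilon>
  for C :: "('o, 'a, 'z) fact_cat_scheme" (structure)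
    and Go :: "'o \<Rightarrow> 'o" and Ga :: "'a \<Rightarrow> 'a" and \<epsilon> :: "'o \<Rightarrow> 'a" +
  assumes counit_M: "X \<in> Obj C \<Longrightarrow> \<epsilon> X \<in> \<M>"


section \<open>Syntopogenous structures\<close>

text \<open>Conditions (T1) and (T2) for a single relation on the subobjects of \<open>X\<close>.\<close>

definition order_relation :: "('o, 'a, 'z) fact_cat_scheme \<Rightarrow> 'o \<Rightarrow> ('a set \<times> 'a set) set \<Rightarrow> bool" where
  "order_relation C X r \<longleftrightarrow>
    r \<subseteq> carrier (Sub C X) \<times> carrier (Sub C X) \<and>
    (\<forall>(m, n) \<in> r. m \<sqsubseteq>\<^bsub>Sub C X\<^esub> n) \<and>
    (\<forall>m \<in> carrier (Sub C X). \<forall>q \<in> carrier (Sub C X). \<forall>(n, p) \<in> r.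
      m \<sqsubseteq>\<^bsub>Sub C X\<^esub> n \<and> p \<sqsubseteq>\<^bsub>Sub C X\<^esub> q \<longrightarrow> (m, q) \<in> r)"

definition topogenous_order ::
  "('o, 'a, 'z) fact_cat_scheme \<Rightarrow> ('o \<Rightarrow> ('a set \<times> 'a set) set) \<Rightarrow> bool" where
  "topogenous_order C R \<longleftrightarrow>
    (\<forall>X \<in> Obj C. order_relation C X (R X)) \<and>
    (\<forall>f \<in> Arr C. \<forall>(m, n) \<in> R (Cod C f). (preimage_sub C f m, preimage_sub C f n) \<in> R (Dom C f))"

definition meet_preserving ::
  "('o, 'a, 'z) fact_cat_scheme \<Rightarrow> 'o \<Rightarrow> ('a set \<times> 'a set) set \<Rightarrow> bool" where
  "meet_preserving C X r \<longleftrightarrow>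
    (\<forall>m \<in> carrier (Sub C X). \<forall>N \<subseteq> carrier (Sub C X).
      (\<forall>n \<in> N. (m, n) \<in> r) \<longrightarrow> (m, \<Sqinter>\<^bsub>Sub C X\<^esub> N) \<in> r)"

definition interpolative :: "('b \<times> 'b) set \<Rightarrow> bool" where
  "interpolative r \<longleftrightarrow> (\<forall>(m, n) \<in> r. \<exists>p. (m, p) \<in> r \<and> (p, n) \<in> r)"

definition syntopogenous ::
  "('o, 'a, 'z) fact_cat_scheme \<Rightarrow> ('o \<Rightarrow> ('a set \<times> 'a set) set set) \<Rightarrow> bool" where
  "syntopogenous C S \<longleftrightarrow>
    (\<forall>X \<in> Obj C. \<forall>r \<in> S X. order_relation C X r) \<and>
    (\<forall>X \<in> Obj C. S X \<noteq> {} \<and> (\<forall>r \<in> S X. \<forall>r' \<in> S X. \<exists>s \<in> S X. r \<subseteq> s \<and> r' \<subseteq> s)) \<and>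
    topogenous_order C (\<lambda>X. \<Union> (S X)) \<and>
    (\<forall>X \<in> Obj C. interpolative (\<Union> (S X)))"

definition co_perfect ::
  "('o, 'a, 'z) fact_cat_scheme \<Rightarrow> ('o \<Rightarrow> ('a set \<times> 'a set) set set) \<Rightarrow> bool" where
  "co_perfect C S \<longleftrightarrow> (\<forall>X \<in> Obj C. \<forall>r \<in> S X. meet_preserving C X r)"


section \<open>Quasi-uniformities\<close>

text \<open>Order-preserving self-maps of the subobject lattice; extensionality outside the carrier makes
  equality of such maps the equality of HOL functions.\<close>

definition order_maps :: "('o, 'a, 'z) fact_cat_scheme \<Rightarrow> 'o \<Rightarrow> ('a set \<Rightarrow> 'a set) set" where
  "order_maps C X =
    {U \<in> carrier (Sub C X) \<rightarrow>\<^sub>E carrier (Sub C X). isotone (Sub C X) (Sub C X) U}"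

definition map_le ::
  "('o, 'a, 'z) fact_cat_scheme \<Rightarrow> 'o \<Rightarrow> ('a set \<Rightarrow> 'a set) \<Rightarrow> ('a set \<Rightarrow> 'a set) \<Rightarrow> bool" where
  "map_le C X U V \<longleftrightarrow> (\<forall>m \<in> carrier (Sub C X). U m \<sqsubseteq>\<^bsub>Sub C X\<^esub> V m)"

definition map_meet ::
  "('o, 'a, 'z) fact_cat_scheme \<Rightarrow> 'o \<Rightarrow> ('a set \<Rightarrow> 'a set) \<Rightarrow> ('a set \<Rightarrow> 'a set) \<Rightarrow> 'a set \<Rightarrow> 'a set" where
  "map_meet C X U V = (\<lambda>m \<in> carrier (Sub C X). U m \<sqinter>\<^bsub>Sub C X\<^esub> V m)"

definition quasi_uniformity_base ::
  "('o, 'a, 'z) fact_cat_scheme \<Rightarrow> ('o \<Rightarrow> ('a set \<Rightarrow> 'a set) set) \<Rightarrow> bool" where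
  "quasi_uniformity_base C B \<longleftrightarrow>
    (\<forall>X \<in> Obj C. B X \<subseteq> order_maps C X) \<and>
    (\<forall>X \<in> Obj C. \<forall>U \<in> B X. \<forall>m \<in> carrier (Sub C X). m \<sqsubseteq>\<^bsub>Sub C X\<^esub> U m) \<and>
    (\<forall>X \<in> Obj C. \<forall>U \<in> B X. \<exists>U' \<in> B X. map_le C X (U' \<circ> U') U) \<and>
    (\<forall>X \<in> Obj C. \<forall>U \<in> B X. \<forall>U' \<in> B X. map_meet C X U U' \<in> B X) \<and>
    (\<forall>f \<in> Arr C. \<forall>U \<in> B (Cod C f). \<exists>U' \<in> B (Dom C f). \<forall>m \<in> carrier (Sub C (Dom C f)).
      image_sub C f (U' m) \<sqsubseteq>\<^bsub>Sub C (Cod C f)\<^esub> U (image_sub C f m))"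

definition quasi_uniformity ::
  "('o, 'a, 'z) fact_cat_scheme \<Rightarrow> ('o \<Rightarrow> ('a set \<Rightarrow> 'a set) set) \<Rightarrow> bool" where
  "quasi_uniformity C \<U> \<longleftrightarrow>
    quasi_uniformity_base C \<U> \<and>
    (\<forall>X \<in> Obj C. \<forall>U \<in> \<U> X. \<forall>V \<in> order_maps C X. map_le C X U V \<longrightarrow> V \<in> \<U> X)"

definition generated ::
  "('o, 'a, 'z) fact_cat_scheme \<Rightarrow> ('o \<Rightarrow> ('a set \<Rightarrow> 'a set) set) \<Rightarrow> 'o \<Rightarrow> ('a set \<Rightarrow> 'a set) set" where
  "generated C B X = {V \<in> order_maps C X. \<exists>U \<in> B X. map_le C X U V}"

definition base_for ::
  "('o, 'a, 'z) fact_cat_scheme \<Rightarrow> ('o \<Rightarrow> ('a set \<Rightarrow> 'a set) set) \<Rightarrow>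
    ('o \<Rightarrow> ('a set \<Rightarrow> 'a set) set) \<Rightarrow> bool" where
  "base_for C B \<U> \<longleftrightarrow>
    quasi_uniformity_base C B \<and> quasi_uniformity C \<U> \<and> (\<forall>X \<in> Obj C. \<U> X = generated C B X)"

definition coarser_eq ::
  "('o, 'a, 'z) fact_cat_scheme \<Rightarrow> ('o \<Rightarrow> ('a set \<Rightarrow> 'a set) set) \<Rightarrow>
    ('o \<Rightarrow> ('a set \<Rightarrow> 'a set) set) \<Rightarrow> bool" where
  "coarser_eq C \<U> \<V> \<longleftrightarrow> (\<forall>X \<in> Obj C. \<forall>U \<in> \<U> X. \<exists>V \<in> \<V> X. map_le C X V U)"

definition finest_such_that ::
  "('o, 'a, 'z) fact_cat_scheme \<Rightarrow> (('o \<Rightarrow> ('a set \<Rightarrow> 'a set) set) \<Rightarrow> bool) \<Rightarrow>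
    ('o \<Rightarrow> ('a set \<Rightarrow> 'a set) set) \<Rightarrow> bool" where
  "finest_such_that C P \<U> \<longleftrightarrow> quasi_uniformity C \<U> \<and> P \<U> \<and>
    (\<forall>\<W>. quasi_uniformity C \<W> \<and> P \<W> \<longrightarrow> coarser_eq C \<W> \<U>)"

definition continuous_arr ::
  "('o, 'a, 'z) fact_cat_scheme \<Rightarrow> ('o \<Rightarrow> ('a set \<Rightarrow> 'a set) set) \<Rightarrow>
    ('o \<Rightarrow> ('a set \<Rightarrow> 'a set) set) \<Rightarrow> 'a \<Rightarrow> bool" where
  "continuous_arr C \<U> \<U>' f \<longleftrightarrow>
    (\<forall>U' \<in> \<U>' (Cod C f). \<exists>U \<in> \<U> (Dom C f). \<forall>m \<in> carrier (Sub C (Dom C f)).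
      image_sub C f (U m) \<sqsubseteq>\<^bsub>Sub C (Cod C f)\<^esub> U' (image_sub C f m))"


section \<open>The quasi-uniformities associated with a co-perfect syntopogenous structure\<close>

definition rel_map ::
  "('o, 'a, 'z) fact_cat_scheme \<Rightarrow> 'o \<Rightarrow> ('a set \<times> 'a set) set \<Rightarrow> 'a set \<Rightarrow> 'a set" where
  "rel_map C X r = (\<lambda>m \<in> carrier (Sub C X). \<Sqinter>\<^bsub>Sub C X\<^esub> {n. (m, n) \<in> r})"

definition synto_base ::
  "('o, 'a, 'z) fact_cat_scheme \<Rightarrow> ('o \<Rightarrow> ('a set \<times> 'a set) set set) \<Rightarrow> 'o \<Rightarrow> ('a set \<Rightarrow> 'a set) set" where
  "synto_base C S X = rel_map C X ` S X"

definition copointed_map ::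
  "('o, 'a, 'z) fact_cat_scheme \<Rightarrow> ('o \<Rightarrow> 'a) \<Rightarrow> 'o \<Rightarrow> ('a set \<Rightarrow> 'a set) \<Rightarrow> 'a set \<Rightarrow> 'a set" where
  "copointed_map C \<epsilon> X V =
    (\<lambda>m \<in> carrier (Sub C X). m \<squnion>\<^bsub>Sub C X\<^esub> image_sub C (\<epsilon> X) (V (preimage_sub C (\<epsilon> X) m)))"

definition copointed_base ::
  "('o, 'a, 'z) fact_cat_scheme \<Rightarrow> ('o \<Rightarrow> 'o) \<Rightarrow> ('o \<Rightarrow> 'a) \<Rightarrow>
    ('o \<Rightarrow> ('a set \<times> 'a set) set set) \<Rightarrow> 'o \<Rightarrow> ('a set \<Rightarrow> 'a set) set" where
  "copointed_base C Go \<epsilon> S X = copointed_map C \<epsilon> X ` synto_base C S (Go X)"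

end

theory Submission
  imports Defs
begin

text \<open>
  Write \<open>e = \<epsilon> X\<close> and \<open>V\<^sup>e(m) = m \<squnion> e(V(e\<^sup>-\<^sup>1(m)))\<close>. The only property of the syntopogenous structure
  that matters is that its maps \<open>V\<close> form a base. Because \<open>e\<close> is in \<open>\<M>\<close>, one has
  \<open>e\<^sup>-\<^sup>1(e(k)) = k\<close>; as \<open>e\<^sup>-\<^sup>1\<close> commutes with joins, \<open>e\<^sup>-\<^sup>1(V\<^sup>e(m)) = V(e\<^sup>-\<^sup>1(m))\<close>, which gives (U2).
  For an arbitrary \<open>\<M>\<close>-morphism \<open>m\<close>, the equation \<open>m(m\<^sup>-\<^sup>1(n)) = m \<sqinter> n\<close> together with the join
  hypothesis makes every subobject lattice distributive, whence \<open>V\<^sup>e \<sqinter> W\<^sup>e = (V \<sqinter> W)\<^sup>e\<close> and (U4).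
  (U5) follows from naturality of \<open>\<epsilon>\<close> and the adjunction between images and preimages. Finally, if
  \<open>e(V(k)) \<le> U(e(k))\<close> for all \<open>k\<close>, then taking \<open>k = e\<^sup>-\<^sup>1(m)\<close> gives \<open>V\<^sup>e(m) \<le> U(m)\<close>, so the generated
  quasi-uniformity is the finest one.
\<close>

section \<open>Factoring through subobjects\<close>

text \<open>The order on subobjects, with an arbitrary arrow \<open>g\<close> allowed on the left.
  Pullbacks, images and intersections are then all described by which arrows factor through them or
  to which arrows they factor.\<close>

definition factors :: "('o, 'a, 'z) cat_scheme \<Rightarrow> 'a \<Rightarrow> 'a \<Rightarrow> bool" where
  "factors C g n \<longleftrightarrow> (\<exists>j \<in> Hom C (Dom C g) (Dom C n). n \<cdot>\<^bsub>C\<^esub> j = g)"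

definition subobjects_of :: "('o, 'a, 'z) fact_cat_scheme \<Rightarrow> 'o \<Rightarrow> 'a set" where
  "subobjects_of C X = {m \<in> \<M>\<^bsub>C\<^esub>. Cod C m = X}"

text \<open>The element of the quotient that \<open>m\<close> represents. The set is empty unless
  \<open>m\<close> lies in \<open>\<M>\<close>, so having a member already yields
  \<open>m \<in> \<M>\<close>.\<close>

definition subobject_class :: "('o, 'a, 'z) fact_cat_scheme \<Rightarrow> 'a \<Rightarrow> 'a set" where
  "subobject_class C m = sub_iso C (Cod C m) `` {m}"

lemma Hom_iff [simp]: "f \<in> Hom C X Y \<longleftrightarrow> f \<in> Arr C \<and> Dom C f = X \<and> Cod C f = Y"
  by (auto simp: Hom_def)

section \<open>Factorization of arrows as a preorder\<close>

context category
begin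

lemma factors_refl: "g \<in> Arr C \<Longrightarrow> factors C g g"
  unfolding factors_def using Comp_Ident Ident_Arr Dom_Ident Cod_Ident Dom_Obj by force

lemma factors_comp_right:
  assumes "factors C g n" "n \<in> Arr C" "h \<in> Arr C" "Cod C h = Dom C g"
  shows "factors C (g \<cdot> h) n"
proof -
  obtain j where j: "j \<in> Arr C" "Dom C j = Dom C g" "Cod C j = Dom C n" "n \<cdot> j = g"
    using assms(1) by (auto simp: factors_def)
  have "g \<cdot> h = n \<cdot> (j \<cdot> h)"
    using j assms Comp_assoc by metis
  then show ?thesis
    unfolding factors_def using j assms Comp_Arr Dom_Comp Cod_Comp by (intro bexI[of _ "j \<cdot> h"]) auto
qed

lemma factors_comp: "\<lbrakk>n \<in> Arr C; j \<in> Arr C; Cod C j = Dom C n\<rbrakk> \<Longrightarrow> factors C (n \<cdot> j) n"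
  using factors_comp_right[OF factors_refl] by blast

lemma factors_trans:
  assumes "factors C g n" "factors C n k" "n \<in> Arr C" "k \<in> Arr C"
  shows "factors C g k"
  using assms factors_comp_right[OF assms(2)] by (force simp: factors_def)

lemma factors_comp_left:
  assumes "factors C g n" "n \<in> Arr C" "f \<in> Arr C" "Cod C n = Dom C f"
  shows "factors C (f \<cdot> g) (f \<cdot> n)"
proof -
  obtain j where j: "j \<in> Arr C" "Dom C j = Dom C g" "Cod C j = Dom C n" "n \<cdot> j = g"
    using assms(1) by (auto simp: factors_def)
  have "f \<cdot> g = (f \<cdot> n) \<cdot> j"
    using j assms Comp_assoc by metis
  then show ?thesis
    using factors_comp[of "f \<cdot> n" j] j assms Comp_Arr Dom_Comp by metis
qed

lemma mono_cancel:
  "\<lbrakk>mono_arr C m; g \<in> Arr C; h \<in> Arr C; Cod C g = Dom C m; Cod C h = Dom C m;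
    Dom C g = Dom C h; m \<cdot> g = m \<cdot> h\<rbrakk> \<Longrightarrow> g = h"
  unfolding mono_arr_def using Dom_Obj by (metis Hom_iff)

text \<open>With \<open>j\<close> and \<open>k\<close> the two comparison arrows,
  \<open>m \<cdot> (j \<cdot> k) = m\<close> and \<open>n \<cdot> (k \<cdot> j) = n\<close>;
  cancelling the monos makes \<open>j\<close> and \<open>k\<close> mutually inverse.\<close>

lemma mutual_factors_iso:
  assumes "mono_arr C m" "mono_arr C n" "factors C m n" "factors C n m"
  obtains j where "j \<in> Hom C (Dom C n) (Dom C m)" "iso_arr C j" "m \<cdot> j = n"
proof -
  have mn: "m \<in> Arr C" "n \<in> Arr C" using assms by (auto simp: mono_arr_def)
  obtain j where j: "j \<in> Arr C" "Dom C j = Dom C n" "Cod C j = Dom C m" "m \<cdot> j = n"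
    using assms(4) by (auto simp: factors_def)
  obtain k where k: "k \<in> Arr C" "Dom C k = Dom C m" "Cod C k = Dom C n" "n \<cdot> k = m"
    using assms(3) by (auto simp: factors_def)
  have "m \<cdot> (j \<cdot> k) = m \<cdot> Ident C (Dom C m)"
    using j k mn Comp_assoc Comp_Ident by metis
  then have jk: "j \<cdot> k = Ident C (Dom C m)"
    using mono_cancel[OF assms(1)] j k mn
    by (metis Comp_Arr Dom_Comp Cod_Comp Ident_Arr Dom_Ident Cod_Ident Dom_Obj)
  have "n \<cdot> (k \<cdot> j) = n \<cdot> Ident C (Dom C n)"
    using j k mn Comp_assoc Comp_Ident by metis
  then have "k \<cdot> j = Ident C (Dom C n)"
    using mono_cancel[OF assms(2)] j k mn
    by (metis Comp_Arr Dom_Comp Cod_Comp Ident_Arr Dom_Ident Cod_Ident Dom_Obj)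
  with jk have "iso_arr C j"
    using j k by (auto simp: iso_arr_def intro!: bexI[of _ k])
  then show thesis using that j by simp
qed

end

section \<open>Subobjects as isomorphism classes, and their order\<close>

context proper_factorization_system
begin

lemma M_Arr: "m \<in> \<M> \<Longrightarrow> m \<in> Arr C"
  using M_mono by (simp add: mono_arr_def)

lemma E_Arr: "e \<in> \<E> \<Longrightarrow> e \<in> Arr C"
  using E_epi by (simp add: epi_arr_def)

lemma subobjects_ofD: "m \<in> subobjects_of C X \<Longrightarrow> m \<in> Arr C \<and> m \<in> \<M> \<and> Cod C m = X"
  using M_Arr by (auto simp: subobjects_of_def)

text \<open>Monos that factor through each other are isomorphic, and conversely an isomorphism can
  be inverted. Isomorphism of representatives thus becomes equivalence for a preorder, which spares
  later arguments the explicit isomorphisms.\<close>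

lemma sub_iso_iff:
  "(m, n) \<in> sub_iso C X \<longleftrightarrow> m \<in> subobjects_of C X \<and> n \<in> subobjects_of C X \<and>
    factors C m n \<and> factors C n m" (is "?L \<longleftrightarrow> ?R")
proof
  assume ?L
  then obtain j where mn: "m \<in> \<M>" "n \<in> \<M>" "Cod C m = X" "Cod C n = X"
    and j: "j \<in> Arr C" "Dom C j = Dom C n" "Cod C j = Dom C m" "iso_arr C j" "m \<cdot> j = n"
    by (auto simp: sub_iso_def)
  obtain k where k: "k \<in> Arr C" "Dom C k = Dom C m" "Cod C k = Dom C n"
    "j \<cdot> k = Ident C (Dom C m)"
    using j by (auto simp: iso_arr_def)
  have "n \<cdot> k = m"
    using k j mn Comp_assoc Comp_Ident M_Arr by metis
  then show ?R
    using mn j k by (auto simp: subobjects_of_def factors_def)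
next
  assume R: ?R
  then obtain j where "j \<in> Hom C (Dom C n) (Dom C m)" "iso_arr C j" "m \<cdot> j = n"
    using mutual_factors_iso[of m n] M_mono subobjects_ofD by blast
  with R show ?L by (auto simp: sub_iso_def subobjects_of_def)
qed

lemma equiv_sub_iso: "equiv (subobjects_of C X) (sub_iso C X)"
proof (rule equivI)
  show "sub_iso C X \<subseteq> subobjects_of C X \<times> subobjects_of C X"
    by (auto simp: sub_iso_iff)
  show "refl_on (subobjects_of C X) (sub_iso C X)"
    using factors_refl subobjects_ofD by (auto simp: refl_on_def sub_iso_iff)
  show "sym (sub_iso C X)"
    by (auto simp: sym_def sub_iso_iff)
  show "trans (sub_iso C X)"
    unfolding trans_def sub_iso_iff using factors_trans subobjects_ofD by metis
qed

lemma carrier_Sub: "carrier (Sub C X) = subobjects_of C X // sub_iso C X"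
  by (simp add: Sub_def subobjects_of_def)

lemma mem_subobject_class:
  "n \<in> subobject_class C m \<longleftrightarrow> m \<in> \<M> \<and> n \<in> \<M> \<and> Cod C n = Cod C m \<and> factors C m n \<and> factors C n m"
  by (auto simp: subobject_class_def sub_iso_iff subobjects_of_def)

lemma subobject_class_self: "m \<in> \<M> \<Longrightarrow> m \<in> subobject_class C m"
  using factors_refl M_Arr by (simp add: mem_subobject_class)

lemma subobject_class_carrier:
  "\<lbrakk>m \<in> \<M>; Cod C m = X\<rbrakk> \<Longrightarrow> subobject_class C m \<in> carrier (Sub C X)"
  by (auto simp: carrier_Sub subobject_class_def subobjects_of_def intro!: quotientI)

lemma carrierE:
  assumes "K \<in> carrier (Sub C X)"
  obtains k where "k \<in> K" "k \<in> \<M>" "Cod C k = X" "K = subobject_class C k"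
proof -
  obtain k where "k \<in> subobjects_of C X" "K = sub_iso C X `` {k}"
    using assms by (auto simp: carrier_Sub elim: quotientE)
  then show thesis
    using that subobject_class_self by (force simp: subobjects_of_def subobject_class_def)
qed

lemma carrier_memD:
  assumes "K \<in> carrier (Sub C X)" "k \<in> K"
  shows "k \<in> \<M>" "k \<in> Arr C" "Cod C k = X"
  using assms M_Arr by (auto elim!: carrierE simp: mem_subobject_class)

lemma carrier_factors:
  assumes "K \<in> carrier (Sub C X)" "k \<in> K" "k' \<in> K"
  shows "factors C k k'"
proof -
  obtain m where m: "m \<in> \<M>" "K = subobject_class C m" using assms(1) by (rule carrierE)
  then show ?thesis
    using assms(2,3) factors_trans[of k m k'] M_Arr by (simp add: mem_subobject_class)
qed

text \<open>Composing with the comparison arrow between \<open>k\<close> and \<open>k'\<close> turns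
  one factorization into the other. A condition on a class may therefore be tested on any
  representative.\<close>

lemma carrier_factors_iff:
  assumes "K \<in> carrier (Sub C X)" "k \<in> K" "k' \<in> K"
  shows "factors C h k \<longleftrightarrow> factors C h k'"
proof -
  have "factors C k k'" "factors C k' k" "k \<in> Arr C" "k' \<in> Arr C"
    using assms carrier_factors carrier_memD by auto
  then show ?thesis using factors_trans[of h k k'] factors_trans[of h k' k] by auto
qed

lemma le_Sub: "N \<sqsubseteq>\<^bsub>Sub C X\<^esub> K \<longleftrightarrow> (\<exists>n \<in> N. \<exists>k \<in> K. factors C n k)"
  by (simp add: Sub_def factors_def)

text \<open>The order of \<open>Sub\<close> asks for some pair of representatives; as all members of
  a class factor through each other, any given pair serves.\<close>

lemma le_Sub_iff:
  assumes "N \<in> carrier (Sub C X)" "K \<in> carrier (Sub C X)" "n \<in> N" "k \<in> K"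
  shows "N \<sqsubseteq>\<^bsub>Sub C X\<^esub> K \<longleftrightarrow> factors C n k"
proof
  assume "N \<sqsubseteq>\<^bsub>Sub C X\<^esub> K"
  then obtain n' k' where *: "n' \<in> N" "k' \<in> K" "factors C n' k'" by (auto simp: le_Sub)
  then have "factors C n' k" using carrier_factors_iff[OF assms(2)] assms(4) by blast
  then show "factors C n k"
    using factors_trans[of n n' k] carrier_factors[OF assms(1,3) *(1)] carrier_memD[OF assms(1) *(1)]
      carrier_memD[OF assms(2,4)] by simp
qed (use assms le_Sub in blast)

text \<open>Antisymmetry yields true equality because the elements are whole classes:
  representatives that factor through each other are related by \<open>sub_iso\<close>, so their
  classes coincide.\<close>

lemma partial_order_Sub: "partial_order (Sub C X)"
proof
  fix x assume "x \<in> carrier (Sub C X)"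
  then show "x \<sqsubseteq>\<^bsub>Sub C X\<^esub> x"
    using carrier_factors by (auto simp: le_Sub elim!: carrierE)
next
  fix x y z
  assume xyz: "x \<in> carrier (Sub C X)" "y \<in> carrier (Sub C X)" "z \<in> carrier (Sub C X)"
    "x \<sqsubseteq>\<^bsub>Sub C X\<^esub> y" "y \<sqsubseteq>\<^bsub>Sub C X\<^esub> z"
  show "x \<sqsubseteq>\<^bsub>Sub C X\<^esub> z"
  proof -
    obtain a b c where abc: "a \<in> x" "b \<in> y" "c \<in> z" using xyz by (meson carrierE)
    then have "factors C a b" "factors C b c" using xyz le_Sub_iff by blast+
    then have "factors C a c"
      using factors_trans[of a b c] carrier_memD(2)[OF xyz(2) abc(2)] carrier_memD(2)[OF xyz(3) abc(3)]
      by simp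
    then show ?thesis using abc le_Sub by blast
  qed
next
  fix x y
  assume *: "x \<sqsubseteq>\<^bsub>Sub C X\<^esub> y" "y \<sqsubseteq>\<^bsub>Sub C X\<^esub> x"
    "x \<in> carrier (Sub C X)" "y \<in> carrier (Sub C X)"
  obtain a b where a: "a \<in> subobjects_of C X" "x = sub_iso C X `` {a}"
    and b: "b \<in> subobjects_of C X" "y = sub_iso C X `` {b}"
    using * by (auto simp: carrier_Sub elim!: quotientE)
  have "a \<in> x" "b \<in> y"
    using a b equiv_class_self[OF equiv_sub_iso] by auto
  then have "(a, b) \<in> sub_iso C X"
    using * a b le_Sub_iff by (auto simp: sub_iso_iff)
  then have "x = y"
    using a b equiv_class_eq[OF equiv_sub_iso] by simp
  then show "x .=\<^bsub>Sub C X\<^esub> y" by (simp add: Sub_def)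
qed (simp_all add: Sub_def)

end

section \<open>Images and preimages of subobjects\<close>

context M_complete_category
begin

text \<open>The infimum of \<open>A\<close> is the class of the intersection of
  \<open>\<Union>A\<close>, the set of all representatives of all members of \<open>A\<close>. A
  partial order with a top and all infima is complete.\<close>

lemma complete_lattice_Sub:
  assumes X: "X \<in> Obj C"
  shows "complete_lattice (Sub C X)"
proof -
  interpret P: partial_order "Sub C X" by (rule partial_order_Sub)
  have inf: "\<exists>i. greatest (Sub C X) i (Lower (Sub C X) A)" if A: "A \<subseteq> carrier (Sub C X)" for A
  proof -
    have sub: "\<Union>A \<subseteq> {m \<in> \<M>. Cod C m = X}"
      using A carrier_memD by blast
    obtain m where m: "is_intersection C X (\<Union>A) m"
      using M_intersection_exists[OF X sub] by blast
    then have mM: "m \<in> \<M>" "Cod C m = X"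
      using M_intersection_stable[OF X sub] by (auto simp: is_intersection_def)
    let ?I = "subobject_class C m"
    have I: "?I \<in> carrier (Sub C X)" "m \<in> ?I"
      using mM subobject_class_carrier subobject_class_self by auto
    have "?I \<sqsubseteq>\<^bsub>Sub C X\<^esub> K" if K: "K \<in> A" for K
    proof -
      obtain k where "k \<in> K" using K A by (meson carrierE subsetD)
      then have "factors C m k"
        using m K by (auto simp: is_intersection_def factors_def)
      then show ?thesis using I \<open>k \<in> K\<close> le_Sub by blast
    qed
    moreover have "L \<sqsubseteq>\<^bsub>Sub C X\<^esub> ?I"
      if L: "L \<in> carrier (Sub C X)" "\<And>K. K \<in> A \<Longrightarrow> L \<sqsubseteq>\<^bsub>Sub C X\<^esub> K" for L
    proof -
      obtain l where l: "l \<in> L" using L(1) by (meson carrierE)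
      note lM = carrier_memD[OF L(1) l]
      have "factors C l n" if "n \<in> \<Union>A" for n
        using that L l A le_Sub_iff by blast
      then have "\<forall>n \<in> \<Union>A. \<exists>j \<in> Hom C (Dom C l) (Dom C n). n \<cdot> j = l"
        by (simp add: factors_def)
      moreover have "\<forall>Z \<in> Obj C. \<forall>g \<in> Hom C Z X.
          (\<forall>n \<in> \<Union>A. \<exists>j \<in> Hom C Z (Dom C n). n \<cdot> j = g) \<longrightarrow>
          (\<exists>!h. h \<in> Hom C Z (Dom C m) \<and> m \<cdot> h = g)"
        using m unfolding is_intersection_def by (elim conjE)
      \<comment> \<open>The universal property of the intersection, used with the representative
        \<open>l\<close> of the lower bound \<open>L\<close> as test arrow.\<close>
      note this[THEN bspec, OF Dom_Obj[OF lM(2)], THEN bspec, of l]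
      ultimately have "\<exists>!h. h \<in> Hom C (Dom C l) (Dom C m) \<and> m \<cdot> h = l"
        using lM by simp
      then have "factors C l m" unfolding factors_def by blast
      then show ?thesis using I l le_Sub by blast
    qed
    ultimately have "greatest (Sub C X) ?I (Lower (Sub C X) A)"
      using I A by (intro greatest_LowerI) (simp_all add: Lower_def subset_iff)
    then show ?thesis ..
  qed
  show ?thesis
  proof (rule P.complete_lattice_criterion1)
    \<comment> \<open>Every subobject is a lower bound of the empty set, so the infimum of the empty
      set is the top.\<close>
    show "\<exists>g. greatest (Sub C X) g (carrier (Sub C X))"
      using inf[of "{}"] by simp
  qed (rule inf)
qed

text \<open>Since \<open>n\<close> and \<open>p\<close> are monic, the second projection and all
  uniqueness claims of the pullback are automatic; what remains is which arrows factor through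
  \<open>p\<close>. This reduces all later work with preimages to \<open>factors\<close>.\<close>

lemma M_pullback_iff:
  assumes "f \<in> Arr C" "n \<in> \<M>" "Cod C n = Cod C f"
  shows "(\<exists>q. is_pullback C f n p q) \<longleftrightarrow> p \<in> \<M> \<and> Cod C p = Dom C f \<and>
    (\<forall>g \<in> Arr C. Cod C g = Dom C f \<longrightarrow> (factors C g p \<longleftrightarrow> factors C (f \<cdot> g) n))"
    (is "?L \<longleftrightarrow> ?R")
proof
  assume ?L
  then obtain q where pb: "is_pullback C f n p q" by blast
  then have p: "p \<in> \<M>" "Cod C p = Dom C f" "p \<in> Arr C"
    and q: "q \<in> Arr C" "Dom C q = Dom C p" "Cod C q = Dom C n" "f \<cdot> p = n \<cdot> q"
    using M_pullback_stable[OF assms(2) pb] M_Arr by (auto simp: is_pullback_def)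
  have "factors C g p \<longleftrightarrow> factors C (f \<cdot> g) n" if g: "g \<in> Arr C" "Cod C g = Dom C f" for g
  proof
    assume "factors C g p"
    then have "factors C (f \<cdot> g) (f \<cdot> p)"
      using factors_comp_left p assms by simp
    moreover have "factors C (f \<cdot> p) n"
      using factors_comp q M_Arr assms by simp
    ultimately show "factors C (f \<cdot> g) n"
      using factors_trans[of "f \<cdot> g" "f \<cdot> p" n] p assms M_Arr Comp_Arr by simp
  next
    assume "factors C (f \<cdot> g) n"
    then obtain b where b: "b \<in> Arr C" "Dom C b = Dom C g" "Cod C b = Dom C n" "n \<cdot> b = f \<cdot> g"
      using g assms Dom_Comp by (auto simp: factors_def)
    moreover have "\<forall>Z \<in> Obj C. \<forall>a \<in> Hom C Z (Dom C f). \<forall>b \<in> Hom C Z (Dom C n).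
      f \<cdot> a = n \<cdot> b \<longrightarrow> (\<exists>!h. h \<in> Hom C Z (Dom C p) \<and> p \<cdot> h = a \<and> q \<cdot> h = b)"
      using pb unfolding is_pullback_def by (elim conjE)
    note this[THEN bspec, OF Dom_Obj[OF g(1)], THEN bspec, of g, THEN bspec, of b]
    ultimately have "\<exists>!h. h \<in> Hom C (Dom C g) (Dom C p) \<and> p \<cdot> h = g \<and> q \<cdot> h = b"
      using g by simp
    then show "factors C g p" unfolding factors_def by blast
  qed
  with p show ?R by simp
next
  assume R: ?R
  then have p: "p \<in> \<M>" "Cod C p = Dom C f" "p \<in> Arr C"
    and fac: "\<And>g. g \<in> Arr C \<Longrightarrow> Cod C g = Dom C f \<Longrightarrow> factors C g p \<longleftrightarrow> factors C (f \<cdot> g) n"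
    using M_Arr by auto
  \<comment> \<open>The criterion at \<open>g = p\<close> itself produces the second projection
    \<open>q\<close>.\<close>
  have "factors C (f \<cdot> p) n" using fac[of p] p factors_refl by simp
  then obtain q where q: "q \<in> Arr C" "Dom C q = Dom C p" "Cod C q = Dom C n" "n \<cdot> q = f \<cdot> p"
    using p assms Dom_Comp by (auto simp: factors_def)
  have n: "n \<in> Arr C" using assms M_Arr by simp
  have "\<exists>!h. h \<in> Hom C Z (Dom C p) \<and> p \<cdot> h = a \<and> q \<cdot> h = b"
    if "a \<in> Hom C Z (Dom C f)" "b \<in> Hom C Z (Dom C n)" "f \<cdot> a = n \<cdot> b" for Z a b
  proof -
    have a: "a \<in> Arr C" "Dom C a = Z" "Cod C a = Dom C f"
      and b: "b \<in> Arr C" "Dom C b = Z" "Cod C b = Dom C n" using that by auto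
    have "factors C a p"
      using fac[of a] a b that(3) n factors_comp[of n b] by simp
    then obtain h where h: "h \<in> Arr C" "Dom C h = Z" "Cod C h = Dom C p" "p \<cdot> h = a"
      using a by (auto simp: factors_def)
    \<comment> \<open>Both sides equal \<open>f \<cdot> a\<close>, and \<open>n\<close> can be
      cancelled.\<close>
    have "n \<cdot> (q \<cdot> h) = n \<cdot> b"
      using that(3) h q p n assms Comp_assoc[of h q n] Comp_assoc[of h p f] by simp
    then have qh: "q \<cdot> h = b"
      using mono_cancel[OF M_mono[OF assms(2)], of "q \<cdot> h" b] h q b Comp_Arr Dom_Comp Cod_Comp by simp
    show ?thesis
    proof (rule ex1I)
      show "h \<in> Hom C Z (Dom C p) \<and> p \<cdot> h = a \<and> q \<cdot> h = b"
        using h qh by simp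
      show "h' = h" if "h' \<in> Hom C Z (Dom C p) \<and> p \<cdot> h' = a \<and> q \<cdot> h' = b" for h'
        using mono_cancel[OF M_mono[OF p(1)], of h' h] h that by simp
    qed
  qed
  then have "is_pullback C f n p q"
    unfolding is_pullback_def using p(2,3) q n assms(1,3)
    by (intro conjI ballI impI; (assumption | simp only: Hom_iff))
  then show ?L ..
qed

text \<open>The factorization criterion depends on \<open>n\<close> only through its class, so one
  representative decides membership for all of \<open>N\<close>.\<close>

lemma mem_preimage_sub:
  assumes f: "f \<in> Arr C" and N: "N \<in> carrier (Sub C (Cod C f))" and n: "n \<in> N"
  shows "p \<in> preimage_sub C f N \<longleftrightarrow> p \<in> \<M> \<and> Cod C p = Dom C f \<and>
    (\<forall>g \<in> Arr C. Cod C g = Dom C f \<longrightarrow> (factors C g p \<longleftrightarrow> factors C (f \<cdot> g) n))"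
    (is "_ \<longleftrightarrow> ?P n")
proof -
  have "p \<in> preimage_sub C f N \<longleftrightarrow> (\<exists>n' \<in> N. ?P n')"
    unfolding preimage_sub_def using M_pullback_iff[OF f] carrier_memD[OF N] by simp
  moreover have "?P n' \<longleftrightarrow> ?P n" if "n' \<in> N" for n'
    by (simp only: carrier_factors_iff[OF N that n])
  ultimately show ?thesis using n by metis
qed

lemma preimage_sub_factors_iff:
  assumes "f \<in> Arr C" "N \<in> carrier (Sub C (Cod C f))" "n \<in> N" "p \<in> preimage_sub C f N"
    "g \<in> Arr C" "Cod C g = Dom C f"
  shows "factors C g p \<longleftrightarrow> factors C (f \<cdot> g) n"
  using mem_preimage_sub[OF assms(1-3), of p] assms(4-6) by simp

text \<open>Pullbacks exist, so the set has a member \<open>p\<close>. Any two members are tested by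
  the same arrows and hence factor through each other, and whatever is equivalent to
  \<open>p\<close> passes the same tests; so the set is exactly one class.\<close>

lemma preimage_sub_carrier [intro, simp]:
  assumes f: "f \<in> Arr C" and N: "N \<in> carrier (Sub C (Cod C f))"
  shows "preimage_sub C f N \<in> carrier (Sub C (Dom C f))"
proof -
  obtain n where n: "n \<in> N" "n \<in> \<M>" "Cod C n = Cod C f" using N by (meson carrierE)
  note mem = mem_preimage_sub[OF f N n(1)]
  obtain p where p: "p \<in> preimage_sub C f N"
    using M_pullback_exists[OF f n(2,3)] n(1) by (auto simp: preimage_sub_def)
  have pM: "p \<in> \<M>" "Cod C p = Dom C f" using mem p by auto
  have "preimage_sub C f N = subobject_class C p"
  proof (intro Set.set_eqI iffI)
    fix r assume r: "r \<in> preimage_sub C f N"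
    then have "r \<in> \<M>" "Cod C r = Dom C f" using mem by auto
    moreover have "factors C r p \<longleftrightarrow> factors C r r" "factors C p r \<longleftrightarrow> factors C p p"
      using mem[of p] mem[of r] p r M_Arr[of p] M_Arr[of r] by auto
    ultimately have "factors C r p" "factors C p r"
      using factors_refl pM M_Arr by auto
    with \<open>r \<in> \<M>\<close> \<open>Cod C r = Dom C f\<close> show "r \<in> subobject_class C p" using pM by (simp add: mem_subobject_class)
  next
    fix r assume "r \<in> subobject_class C p"
    then have r: "r \<in> \<M>" "Cod C r = Dom C f" "factors C r p" "factors C p r"
      using pM by (auto simp: mem_subobject_class)
    have "factors C g r \<longleftrightarrow> factors C g p" for g
      using factors_trans[of g r p] factors_trans[of g p r] r pM M_Arr by auto
    then show "r \<in> preimage_sub C f N" using mem[of p] mem[of r] p r by simp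
  qed
  then show ?thesis using subobject_class_carrier pM by simp
qed

lemma le_preimage_sub_iff:
  assumes "f \<in> Arr C" "N \<in> carrier (Sub C (Cod C f))" "K \<in> carrier (Sub C (Dom C f))"
    "k \<in> K" "n \<in> N"
  shows "K \<sqsubseteq>\<^bsub>Sub C (Dom C f)\<^esub> preimage_sub C f N \<longleftrightarrow> factors C (f \<cdot> k) n"
proof -
  obtain p where "p \<in> preimage_sub C f N"
    using preimage_sub_carrier[OF assms(1,2)] by (meson carrierE)
  then show ?thesis
    using mem_preimage_sub[OF assms(1,2,5), of p] carrier_memD[OF assms(3,4)]
      le_Sub_iff[OF assms(3) preimage_sub_carrier[OF assms(1,2)] assms(4), of p] by simp
qed

text \<open>The diagonal of the square formed by \<open>e\<close> and \<open>k\<close> factors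
  \<open>n\<close> through \<open>k\<close>. So \<open>n\<close> is the least
  \<open>\<M>\<close>-morphism through which \<open>n \<cdot> e\<close> factors, which is the
  universal property of the image.\<close>

lemma image_factors_iff:
  assumes "e \<in> \<E>" "n \<in> \<M>" "Dom C n = Cod C e" "k \<in> \<M>" "Cod C k = Cod C n"
  shows "factors C n k \<longleftrightarrow> factors C (n \<cdot> e) k"
proof
  show "factors C n k \<Longrightarrow> factors C (n \<cdot> e) k"
    using factors_comp_right assms M_Arr E_Arr by simp
next
  assume "factors C (n \<cdot> e) k"
  then obtain u where "u \<in> Hom C (Dom C e) (Dom C k)" "k \<cdot> u = n \<cdot> e"
    using assms M_Arr E_Arr Dom_Comp by (auto simp: factors_def)
  then obtain w where "w \<in> Hom C (Cod C e) (Dom C k)" "k \<cdot> w = n"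
    using diagonalization[OF assms(1,4), of u n] assms M_Arr by auto
  then show "factors C n k" using assms by (auto simp: factors_def)
qed

text \<open>The factorization behind \<open>n\<close> may start from another representative
  \<open>k'\<close> of \<open>K\<close>, but \<open>f \<cdot> k\<close> and
  \<open>f \<cdot> k'\<close> factor through each other and thus through the same
  \<open>l\<close>.\<close>

lemma mem_image_subD:
  assumes f: "f \<in> Arr C" and K: "K \<in> carrier (Sub C (Dom C f))"
    and n: "n \<in> image_sub C f K" and k: "k \<in> K"
  shows "n \<in> \<M>" "Cod C n = Cod C f"
    "\<lbrakk>l \<in> \<M>; Cod C l = Cod C f\<rbrakk> \<Longrightarrow> factors C n l \<longleftrightarrow> factors C (f \<cdot> k) l"
proof -
  obtain k' e where *: "n \<in> \<M>" "k' \<in> K" "e \<in> \<E>" "Dom C n = Cod C e" "f \<cdot> k' = n \<cdot> e"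
    using n by (auto simp: image_sub_def)
  show "n \<in> \<M>" by fact
  note k' = carrier_memD[OF K \<open>k' \<in> K\<close>] and kM = carrier_memD[OF K k]
  show "Cod C n = Cod C f"
    using *(3-5) f k' M_Arr[OF *(1)] E_Arr Cod_Comp by metis
  assume l: "l \<in> \<M>" "Cod C l = Cod C f"
  have "factors C (f \<cdot> k) (f \<cdot> k')" "factors C (f \<cdot> k') (f \<cdot> k)" "f \<cdot> k \<in> Arr C" "f \<cdot> k' \<in> Arr C"
    using carrier_factors[OF K] *(2) k k' kM f factors_comp_left Comp_Arr by auto
  then have "factors C (f \<cdot> k) l \<longleftrightarrow> factors C (f \<cdot> k') l"
    using factors_trans[of "f \<cdot> k" "f \<cdot> k'" l] factors_trans[of "f \<cdot> k'" "f \<cdot> k" l] l M_Arr by auto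
  then show "factors C n l \<longleftrightarrow> factors C (f \<cdot> k) l"
    using * image_factors_iff[OF *(3,1,4) l(1)] l \<open>Cod C n = Cod C f\<close> by simp
qed

text \<open>By the universal property any two images factor through each other; conversely, every
  arrow isomorphic to an image is an image.\<close>

lemma image_sub_carrier [intro, simp]:
  assumes f: "f \<in> Arr C" and K: "K \<in> carrier (Sub C (Dom C f))"
  shows "image_sub C f K \<in> carrier (Sub C (Cod C f))"
proof -
  obtain k where k: "k \<in> K" "k \<in> \<M>" "Cod C k = Dom C f" using K by (meson carrierE)
  then obtain e n where en: "e \<in> \<E>" "n \<in> \<M>" "Dom C n = Cod C e" "f \<cdot> k = n \<cdot> e"
    using factorization[of "f \<cdot> k"] f M_Arr Comp_Arr by metis
  then have n: "n \<in> image_sub C f K" using k by (auto simp: image_sub_def)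
  note nM = mem_image_subD[OF f K n k(1)]
  have "image_sub C f K = subobject_class C n"
  proof (intro Set.set_eqI iffI)
    fix r assume "r \<in> image_sub C f K"
    note r = mem_image_subD[OF f K this k(1)]
    have "factors C n r \<longleftrightarrow> factors C r r" "factors C r n \<longleftrightarrow> factors C n n"
      using nM r by auto
    then show "r \<in> subobject_class C n"
      using nM(1,2) r(1,2) factors_refl M_Arr by (simp add: mem_subobject_class)
  next
    fix r assume "r \<in> subobject_class C n"
    then have r: "r \<in> \<M>" "Cod C r = Cod C n" "factors C n r" "factors C r n"
      by (auto simp: mem_subobject_class)
    obtain j where j: "j \<in> Hom C (Dom C n) (Dom C r)" "iso_arr C j" "r \<cdot> j = n"
      using mutual_factors_iso[OF M_mono[OF r(1)] M_mono[OF en(2)] r(4,3)] by blast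
    \<comment> \<open>The isomorphism \<open>j\<close> is absorbed into the \<open>\<E>\<close>-part
      of the factorization.\<close>
    have "j \<cdot> e \<in> \<E>" "Cod C (j \<cdot> e) = Dom C r"
      using j en iso_E E_Comp Cod_Comp E_Arr by auto
    moreover have "f \<cdot> k = r \<cdot> (j \<cdot> e)"
      using j en r M_Arr E_Arr Comp_assoc by auto
    ultimately show "r \<in> image_sub C f K"
      using r k unfolding image_sub_def by force
  qed
  then show ?thesis using subobject_class_carrier nM by simp
qed

lemma image_sub_le_factors_iff:
  assumes "f \<in> Arr C" "N \<in> carrier (Sub C (Cod C f))" "K \<in> carrier (Sub C (Dom C f))"
    "k \<in> K" "n \<in> N"
  shows "image_sub C f K \<sqsubseteq>\<^bsub>Sub C (Cod C f)\<^esub> N \<longleftrightarrow> factors C (f \<cdot> k) n"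
proof -
  obtain p where "p \<in> image_sub C f K"
    using image_sub_carrier[OF assms(1,3)] by (meson carrierE)
  then show ?thesis
    using mem_image_subD(3)[OF assms(1,3) _ assms(4), where n = p and l = n] carrier_memD[OF assms(2,5)]
      le_Sub_iff[OF image_sub_carrier[OF assms(1,3)] assms(2) _ assms(5), of p] by simp
qed

text \<open>For representatives \<open>k\<close> and \<open>n\<close>, both inequalities say that
  \<open>f \<cdot> k\<close> factors through \<open>n\<close>.\<close>

lemma image_preimage_adjoint:
  assumes "f \<in> Arr C" "N \<in> carrier (Sub C (Cod C f))" "K \<in> carrier (Sub C (Dom C f))"
  shows "image_sub C f K \<sqsubseteq>\<^bsub>Sub C (Cod C f)\<^esub> N \<longleftrightarrow> K \<sqsubseteq>\<^bsub>Sub C (Dom C f)\<^esub> preimage_sub C f N"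
proof -
  obtain k n where "k \<in> K" "n \<in> N"
    using assms(2,3) by (meson carrierE)
  then show ?thesis
    using image_sub_le_factors_iff[OF assms] le_preimage_sub_iff[OF assms] by simp
qed

end

section \<open>Distributivity of subobject lattices\<close>

context lattice
begin

text \<open>Distributing twice bounds the left side by the join of
  \<open>(x \<squnion> y) \<sqinter> x\<close>, \<open>z \<sqinter> x\<close> and
  \<open>z \<sqinter> y\<close>, each of which is below the right side.\<close>

lemma dual_distrib_le:
  assumes distrib: "\<And>x y z. \<lbrakk>x \<in> carrier L; y \<in> carrier L; z \<in> carrier L\<rbrakk>
      \<Longrightarrow> x \<sqinter> (y \<squnion> z) \<sqsubseteq> (x \<sqinter> y) \<squnion> (x \<sqinter> z)"
    and c: "x \<in> carrier L" "y \<in> carrier L" "z \<in> carrier L"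
  shows "(x \<squnion> y) \<sqinter> (x \<squnion> z) \<sqsubseteq> x \<squnion> (y \<sqinter> z)"
proof -
  let ?R = "x \<squnion> (y \<sqinter> z)"
  have cl: "y \<sqinter> z \<in> carrier L" "?R \<in> carrier L" "x \<squnion> y \<in> carrier L" "x \<squnion> z \<in> carrier L"
    "(x \<squnion> y) \<sqinter> x \<in> carrier L" "(x \<squnion> y) \<sqinter> z \<in> carrier L" "z \<sqinter> x \<in> carrier L" "z \<sqinter> y \<in> carrier L"
    "z \<sqinter> (x \<squnion> y) \<in> carrier L" "(x \<squnion> y) \<sqinter> (x \<squnion> z) \<in> carrier L"
    "((x \<squnion> y) \<sqinter> x) \<squnion> ((x \<squnion> y) \<sqinter> z) \<in> carrier L" "(z \<sqinter> x) \<squnion> (z \<sqinter> y) \<in> carrier L"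
    using c by simp_all
  have x: "x \<sqsubseteq> ?R" and yz: "y \<sqinter> z \<sqsubseteq> ?R" using c cl by (simp_all add: join_left join_right)
  have "(x \<squnion> y) \<sqinter> x \<sqsubseteq> ?R" using meet_right[OF cl(3) c(1)] x cl c le_trans by blast
  moreover have "z \<sqinter> x \<sqsubseteq> ?R" using meet_right[OF c(3,1)] x cl c le_trans by blast
  moreover have "z \<sqinter> y \<sqsubseteq> ?R" using yz meet_comm[of L z y] by simp
  ultimately have "(z \<sqinter> x) \<squnion> (z \<sqinter> y) \<sqsubseteq> ?R" "(x \<squnion> y) \<sqinter> x \<sqsubseteq> ?R"
    using cl join_le by blast+
  moreover have "(x \<squnion> y) \<sqinter> z \<sqsubseteq> (z \<sqinter> x) \<squnion> (z \<sqinter> y)"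
    using distrib[OF c(3,1,2)] meet_comm[of L z "x \<squnion> y"] by simp
  ultimately have "((x \<squnion> y) \<sqinter> x) \<squnion> ((x \<squnion> y) \<sqinter> z) \<sqsubseteq> ?R"
    using cl join_le le_trans by metis
  then show ?thesis using distrib[OF cl(3) c(1,3)] cl le_trans by blast
qed

end

section \<open>Images and preimages along \<open>\<M>\<close>-morphisms, and the distributive
  law\<close>

context M_complete_category
begin

lemma lattice_Sub: "X \<in> Obj C \<Longrightarrow> lattice (Sub C X)"
  by (rule complete_lattice_lattice[OF complete_lattice_Sub])

lemmas Sub_refl = partial_order.axioms(1)[OF partial_order_Sub, THEN weak_partial_order.le_refl]

lemma Sub_trans:
  "\<lbrakk>a \<sqsubseteq>\<^bsub>Sub C X\<^esub> b; b \<sqsubseteq>\<^bsub>Sub C X\<^esub> c; a \<in> carrier (Sub C X); b \<in> carrier (Sub C X);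
    c \<in> carrier (Sub C X)\<rbrakk> \<Longrightarrow> a \<sqsubseteq>\<^bsub>Sub C X\<^esub> c"
  using weak_partial_order.le_trans[OF partial_order.axioms(1)[OF partial_order_Sub]] by metis

lemma Sub_antisym:
  "\<lbrakk>a \<sqsubseteq>\<^bsub>Sub C X\<^esub> b; b \<sqsubseteq>\<^bsub>Sub C X\<^esub> a; a \<in> carrier (Sub C X); b \<in> carrier (Sub C X)\<rbrakk> \<Longrightarrow> a = b"
  using partial_order.le_antisym[OF partial_order_Sub] by metis

lemma le_preimage_image:
  "\<lbrakk>f \<in> Arr C; K \<in> carrier (Sub C (Dom C f))\<rbrakk>
    \<Longrightarrow> K \<sqsubseteq>\<^bsub>Sub C (Dom C f)\<^esub> preimage_sub C f (image_sub C f K)"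
  using image_preimage_adjoint Sub_refl image_sub_carrier by blast

lemma image_preimage_le:
  "\<lbrakk>f \<in> Arr C; N \<in> carrier (Sub C (Cod C f))\<rbrakk>
    \<Longrightarrow> image_sub C f (preimage_sub C f N) \<sqsubseteq>\<^bsub>Sub C (Cod C f)\<^esub> N"
  using image_preimage_adjoint Sub_refl preimage_sub_carrier by blast

lemma image_sub_mono:
  assumes "f \<in> Arr C" "K \<in> carrier (Sub C (Dom C f))" "L \<in> carrier (Sub C (Dom C f))"
    "K \<sqsubseteq>\<^bsub>Sub C (Dom C f)\<^esub> L"
  shows "image_sub C f K \<sqsubseteq>\<^bsub>Sub C (Cod C f)\<^esub> image_sub C f L"
  using assms image_preimage_adjoint[OF assms(1) _ assms(2)] image_sub_carrier preimage_sub_carrier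
    le_preimage_image[OF assms(1,3)] Sub_trans by meson

lemma preimage_sub_mono:
  assumes "f \<in> Arr C" "K \<in> carrier (Sub C (Cod C f))" "L \<in> carrier (Sub C (Cod C f))"
    "K \<sqsubseteq>\<^bsub>Sub C (Cod C f)\<^esub> L"
  shows "preimage_sub C f K \<sqsubseteq>\<^bsub>Sub C (Dom C f)\<^esub> preimage_sub C f L"
  using assms image_preimage_adjoint[OF assms(1,3)] image_sub_carrier preimage_sub_carrier
    image_preimage_le[OF assms(1,2)] Sub_trans by meson

text \<open>Both sides have the same subobjects \<open>K\<close> below them: for either one, the
  condition is that \<open>g \<cdot> (f \<cdot> k)\<close> factors through \<open>n\<close>.\<close>

lemma preimage_sub_Comp:
  assumes f: "f \<in> Arr C" and g: "g \<in> Arr C" "Dom C g = Cod C f"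
    and N: "N \<in> carrier (Sub C (Cod C g))"
  shows "preimage_sub C (g \<cdot> f) N = preimage_sub C f (preimage_sub C g N)"
proof -
  have gf: "g \<cdot> f \<in> Arr C" "Dom C (g \<cdot> f) = Dom C f" "Cod C (g \<cdot> f) = Cod C g"
    using f g Comp_Arr Dom_Comp Cod_Comp by auto
  have gN: "preimage_sub C g N \<in> carrier (Sub C (Cod C f))"
    using g N preimage_sub_carrier by metis
  have c: "preimage_sub C (g \<cdot> f) N \<in> carrier (Sub C (Dom C f))"
    "preimage_sub C f (preimage_sub C g N) \<in> carrier (Sub C (Dom C f))"
    using gf N gN f preimage_sub_carrier by metis+
  have "K \<sqsubseteq>\<^bsub>Sub C (Dom C f)\<^esub> preimage_sub C (g \<cdot> f) N \<longleftrightarrow>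
      K \<sqsubseteq>\<^bsub>Sub C (Dom C f)\<^esub> preimage_sub C f (preimage_sub C g N)"
    if K: "K \<in> carrier (Sub C (Dom C f))" for K
  proof -
    obtain k n p where k: "k \<in> K" and n: "n \<in> N" and p: "p \<in> preimage_sub C g N"
      using K N gN by (meson carrierE)
    note kM = carrier_memD[OF K k]
    have "K \<sqsubseteq>\<^bsub>Sub C (Dom C f)\<^esub> preimage_sub C (g \<cdot> f) N \<longleftrightarrow> factors C ((g \<cdot> f) \<cdot> k) n"
      using le_preimage_sub_iff[of "g \<cdot> f" N K k n] gf N K k n by simp
    also have "(g \<cdot> f) \<cdot> k = g \<cdot> (f \<cdot> k)"
      using f g kM Comp_assoc by simp
    also have "factors C (g \<cdot> (f \<cdot> k)) n \<longleftrightarrow> factors C (f \<cdot> k) p"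
      using preimage_sub_factors_iff[OF g(1) N n p, of "f \<cdot> k"] f g kM Comp_Arr Cod_Comp by simp
    also have "factors C (f \<cdot> k) p \<longleftrightarrow> K \<sqsubseteq>\<^bsub>Sub C (Dom C f)\<^esub> preimage_sub C f (preimage_sub C g N)"
      using le_preimage_sub_iff[OF f gN K k p] by simp
    finally show ?thesis .
  qed
  then show ?thesis using c Sub_refl Sub_antisym by blast
qed

text \<open>As \<open>\<M>\<close> is closed under composition, \<open>f \<cdot> k\<close> is its
  own image. A representative \<open>p\<close> of the left side then has \<open>f \<cdot> p\<close>
  factoring through \<open>f \<cdot> k\<close>, and cancelling the mono \<open>f\<close> leaves
  \<open>p\<close> factoring through \<open>k\<close>.\<close>

lemma preimage_image_M:
  assumes "f \<in> \<M>" "K \<in> carrier (Sub C (Dom C f))"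
  shows "preimage_sub C f (image_sub C f K) = K"
proof -
  have f: "f \<in> Arr C" using assms M_Arr by simp
  note I = image_sub_carrier[OF f assms(2)]
  note P = preimage_sub_carrier[OF f I]
  obtain k n p where k: "k \<in> K" and n: "n \<in> image_sub C f K"
    and p: "p \<in> preimage_sub C f (image_sub C f K)"
    using assms(2) I P by (meson carrierE)
  note kM = carrier_memD[OF assms(2) k] and pM = carrier_memD[OF P p]
  have fk: "f \<cdot> k \<in> \<M>" "Cod C (f \<cdot> k) = Cod C f"
    using assms kM M_Comp Cod_Comp f by auto
  have "factors C (f \<cdot> p) n"
    using preimage_sub_factors_iff[OF f I n p, of p] pM factors_refl by simp
  moreover have "factors C n (f \<cdot> k)"
    using mem_image_subD(3)[OF f assms(2) n k fk] fk factors_refl M_Arr by simp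
  ultimately have "factors C (f \<cdot> p) (f \<cdot> k)"
    using factors_trans carrier_memD[OF I n] fk M_Arr by blast
  then obtain j where j: "j \<in> Arr C" "Dom C j = Dom C p" "Cod C j = Dom C k" "(f \<cdot> k) \<cdot> j = f \<cdot> p"
    using f pM kM Dom_Comp by (auto simp: factors_def)
  have "f \<cdot> (k \<cdot> j) = f \<cdot> p" using j kM f Comp_assoc by simp
  then have "k \<cdot> j = p"
    using mono_cancel[OF M_mono[OF assms(1)], of "k \<cdot> j" p] j kM pM Comp_Arr Dom_Comp Cod_Comp by simp
  then have "factors C p k" using j by (auto simp: factors_def)
  then have "preimage_sub C f (image_sub C f K) \<sqsubseteq>\<^bsub>Sub C (Dom C f)\<^esub> K"
    using p k le_Sub by blast
  then show ?thesis
    using le_preimage_image[OF f assms(2)] P assms(2) Sub_antisym by blast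
qed

lemma image_le_class_M:
  assumes "f \<in> \<M>" "K \<in> carrier (Sub C (Dom C f))"
  shows "image_sub C f K \<sqsubseteq>\<^bsub>Sub C (Cod C f)\<^esub> subobject_class C f"
proof -
  have f: "f \<in> Arr C" using assms M_Arr by simp
  obtain k where k: "k \<in> K" using assms(2) by (meson carrierE)
  have "factors C (f \<cdot> k) f"
    using factors_comp carrier_memD[OF assms(2) k] f by simp
  then show ?thesis
    using image_sub_le_factors_iff[OF f _ assms(2) k] subobject_class_self subobject_class_carrier
      assms by blast
qed

text \<open>If \<open>n = f \<cdot> j\<close>, then \<open>j\<close> factors through the pullback
  \<open>p\<close> of \<open>n\<close>, so \<open>n\<close> factors through
  \<open>f \<cdot> p\<close> and hence through the image.\<close>

lemma image_preimage_M:
  assumes f: "f \<in> \<M>" and N: "N \<in> carrier (Sub C (Cod C f))"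
    and le: "N \<sqsubseteq>\<^bsub>Sub C (Cod C f)\<^esub> subobject_class C f"
  shows "image_sub C f (preimage_sub C f N) = N"
proof -
  have fA: "f \<in> Arr C" using f M_Arr by simp
  note P = preimage_sub_carrier[OF fA N]
  note I = image_sub_carrier[OF fA P]
  obtain n where n: "n \<in> N" using N by (meson carrierE)
  note nM = carrier_memD[OF N n]
  have "factors C n f"
    using le le_Sub_iff[OF N _ n subobject_class_self[OF f]] subobject_class_carrier[OF f] by simp
  then obtain j where j: "j \<in> Arr C" "Dom C j = Dom C n" "Cod C j = Dom C f" "f \<cdot> j = n"
    by (auto simp: factors_def)
  obtain p i where p: "p \<in> preimage_sub C f N" and i: "i \<in> image_sub C f (preimage_sub C f N)"
    using P I by (meson carrierE)
  note pM = carrier_memD[OF P p] and iM = carrier_memD[OF I i]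
  have "factors C j p"
    using preimage_sub_factors_iff[OF fA N n p, of j] j nM factors_refl by simp
  then have "factors C n (f \<cdot> p)"
    using factors_comp_left pM fA j(4) by metis
  moreover have "factors C (f \<cdot> p) i"
    using mem_image_subD(3)[OF fA P i p, of i] iM factors_refl by simp
  ultimately have "factors C n i"
    using factors_trans pM iM fA Comp_Arr by metis
  then have "N \<sqsubseteq>\<^bsub>Sub C (Cod C f)\<^esub> image_sub C f (preimage_sub C f N)"
    using n i le_Sub by blast
  then show ?thesis using image_preimage_le[OF fA N] I N Sub_antisym by blast
qed

text \<open>The meet on the left lies below \<open>f\<close>, so it is the image of its preimage,
  and that preimage is below both \<open>K\<close> and \<open>L\<close> because the preimage undoes
  the image.\<close>

lemma image_meet_M:
  assumes f: "f \<in> \<M>" and K: "K \<in> carrier (Sub C (Dom C f))" and L: "L \<in> carrier (Sub C (Dom C f))"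
  shows "image_sub C f K \<sqinter>\<^bsub>Sub C (Cod C f)\<^esub> image_sub C f L
    \<sqsubseteq>\<^bsub>Sub C (Cod C f)\<^esub> image_sub C f (K \<sqinter>\<^bsub>Sub C (Dom C f)\<^esub> L)"
proof -
  have fA: "f \<in> Arr C" using f M_Arr by simp
  interpret D: lattice "Sub C (Dom C f)" using lattice_Sub Dom_Obj fA by simp
  interpret R: lattice "Sub C (Cod C f)" using lattice_Sub Cod_Obj fA by simp
  let ?N = "image_sub C f K \<sqinter>\<^bsub>Sub C (Cod C f)\<^esub> image_sub C f L"
  have N: "?N \<in> carrier (Sub C (Cod C f))"
    and le: "?N \<sqsubseteq>\<^bsub>Sub C (Cod C f)\<^esub> image_sub C f K" "?N \<sqsubseteq>\<^bsub>Sub C (Cod C f)\<^esub> image_sub C f L"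
    using K L fA R.meet_left R.meet_right by auto
  note P = preimage_sub_carrier[OF fA N]
  have "preimage_sub C f ?N \<sqsubseteq>\<^bsub>Sub C (Dom C f)\<^esub> K" "preimage_sub C f ?N \<sqsubseteq>\<^bsub>Sub C (Dom C f)\<^esub> L"
    using preimage_sub_mono[OF fA N _ le(1)] preimage_sub_mono[OF fA N _ le(2)]
      preimage_image_M[OF f] K L fA by auto
  then have "image_sub C f (preimage_sub C f ?N)
      \<sqsubseteq>\<^bsub>Sub C (Cod C f)\<^esub> image_sub C f (K \<sqinter>\<^bsub>Sub C (Dom C f)\<^esub> L)"
    using D.meet_le P K L fA image_sub_mono by auto
  moreover have "?N \<sqsubseteq>\<^bsub>Sub C (Cod C f)\<^esub> subobject_class C f"
    by (rule R.le_trans[OF le(1) image_le_class_M[OF f K]])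
      (use N K fA subobject_class_carrier[OF f] in simp_all)
  ultimately show ?thesis using image_preimage_M[OF f N] by simp
qed

lemma preimage_join:
  assumes "preimages_commute_with_joins C" "f \<in> Arr C"
    "K \<in> carrier (Sub C (Cod C f))" "L \<in> carrier (Sub C (Cod C f))"
  shows "preimage_sub C f (K \<squnion>\<^bsub>Sub C (Cod C f)\<^esub> L) =
    preimage_sub C f K \<squnion>\<^bsub>Sub C (Dom C f)\<^esub> preimage_sub C f L"
proof -
  have "{K, L} \<subseteq> carrier (Sub C (Cod C f))" using assms by simp
  then have "preimage_sub C f (\<Squnion>\<^bsub>Sub C (Cod C f)\<^esub> {K, L}) =
      \<Squnion>\<^bsub>Sub C (Dom C f)\<^esub> (preimage_sub C f ` {K, L})"
    using assms(1,2) unfolding preimages_commute_with_joins_def by blast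
  then show ?thesis by (simp add: join_def)
qed

text \<open>The image map is a left adjoint and therefore preserves joins; this inequality is the
  part of that fact used for distributivity.\<close>

lemma image_join_le:
  assumes f: "f \<in> Arr C" and K: "K \<in> carrier (Sub C (Dom C f))" "L \<in> carrier (Sub C (Dom C f))"
    and N: "N \<in> carrier (Sub C (Cod C f))"
    and le: "image_sub C f K \<sqsubseteq>\<^bsub>Sub C (Cod C f)\<^esub> N" "image_sub C f L \<sqsubseteq>\<^bsub>Sub C (Cod C f)\<^esub> N"
  shows "image_sub C f (K \<squnion>\<^bsub>Sub C (Dom C f)\<^esub> L) \<sqsubseteq>\<^bsub>Sub C (Cod C f)\<^esub> N"
proof -
  interpret D: lattice "Sub C (Dom C f)" using lattice_Sub Dom_Obj f by simp
  show ?thesis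
    using image_preimage_adjoint[OF f N] K le D.join_le N f by simp
qed

text \<open>Let \<open>m\<close> represent \<open>x\<close>. Meeting with \<open>x\<close> amounts
  to taking the preimage along \<open>m\<close> and then the image. The first map preserves joins by
  hypothesis, the second as a left adjoint.\<close>

lemma Sub_distrib_le:
  assumes joins: "preimages_commute_with_joins C" and X: "X \<in> Obj C"
    and x: "x \<in> carrier (Sub C X)" and y: "y \<in> carrier (Sub C X)" and z: "z \<in> carrier (Sub C X)"
  shows "x \<sqinter>\<^bsub>Sub C X\<^esub> (y \<squnion>\<^bsub>Sub C X\<^esub> z) \<sqsubseteq>\<^bsub>Sub C X\<^esub>
    (x \<sqinter>\<^bsub>Sub C X\<^esub> y) \<squnion>\<^bsub>Sub C X\<^esub> (x \<sqinter>\<^bsub>Sub C X\<^esub> z)"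
proof -
  obtain m where m: "m \<in> \<M>" "Cod C m = X" "x = subobject_class C m"
    using x by (elim carrierE) auto
  have mA: "m \<in> Arr C" using m M_Arr by simp
  interpret R: lattice "Sub C X" using lattice_Sub X by simp
  interpret D: lattice "Sub C (Dom C m)" using lattice_Sub Dom_Obj mA by simp
  let ?N = "x \<sqinter>\<^bsub>Sub C X\<^esub> (y \<squnion>\<^bsub>Sub C X\<^esub> z)"
  let ?R = "(x \<sqinter>\<^bsub>Sub C X\<^esub> y) \<squnion>\<^bsub>Sub C X\<^esub> (x \<sqinter>\<^bsub>Sub C X\<^esub> z)"
  let ?y = "preimage_sub C m y" and ?z = "preimage_sub C m z"
  have N: "?N \<in> carrier (Sub C X)" "?R \<in> carrier (Sub C X)" "y \<squnion>\<^bsub>Sub C X\<^esub> z \<in> carrier (Sub C X)"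
    using x y z by auto
  have yz: "?y \<in> carrier (Sub C (Dom C m))" "?z \<in> carrier (Sub C (Dom C m))"
    using y z mA m(2) by auto
  have part: "image_sub C m (preimage_sub C m w) \<sqsubseteq>\<^bsub>Sub C X\<^esub> x \<sqinter>\<^bsub>Sub C X\<^esub> w"
    if w: "w \<in> carrier (Sub C X)" for w
    using image_le_class_M[OF m(1), of "preimage_sub C m w"] image_preimage_le[OF mA, of w]
      w mA m x R.meet_le by auto
  have im: "image_sub C m ?y \<in> carrier (Sub C X)" "image_sub C m ?z \<in> carrier (Sub C X)"
    using image_sub_carrier[OF mA] yz m(2) by auto
  have "image_sub C m ?y \<sqsubseteq>\<^bsub>Sub C X\<^esub> ?R" "image_sub C m ?z \<sqsubseteq>\<^bsub>Sub C X\<^esub> ?R"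
    using R.le_trans[OF part[OF y] R.join_left im(1)] R.le_trans[OF part[OF z] R.join_right im(2)]
      N(2) x y z by simp_all
  then have "image_sub C m (?y \<squnion>\<^bsub>Sub C (Dom C m)\<^esub> ?z) \<sqsubseteq>\<^bsub>Sub C X\<^esub> ?R"
    using image_join_le[OF mA yz] m(2) N by simp
  then have R: "image_sub C m (preimage_sub C m (y \<squnion>\<^bsub>Sub C X\<^esub> z)) \<sqsubseteq>\<^bsub>Sub C X\<^esub> ?R"
    using preimage_join[OF joins mA] y z m(2) by simp
  have "?N \<sqsubseteq>\<^bsub>Sub C X\<^esub> y \<squnion>\<^bsub>Sub C X\<^esub> z" "?N \<sqsubseteq>\<^bsub>Sub C X\<^esub> x"
    using R.meet_left R.meet_right x N by auto
  \<comment> \<open>Because \<open>?N\<close> is below \<open>x\<close>, the class of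
    \<open>m\<close>, it is recovered from its preimage along \<open>m\<close>.\<close>
  then have "?N = image_sub C m (preimage_sub C m ?N)"
    and "preimage_sub C m ?N \<sqsubseteq>\<^bsub>Sub C (Dom C m)\<^esub> preimage_sub C m (y \<squnion>\<^bsub>Sub C X\<^esub> z)"
    using image_preimage_M[OF m(1), of ?N] preimage_sub_mono[OF mA, of ?N] N(1,3) m(2,3) by auto
  then have "?N = image_sub C m (preimage_sub C m ?N)"
    and "image_sub C m (preimage_sub C m ?N)
      \<sqsubseteq>\<^bsub>Sub C X\<^esub> image_sub C m (preimage_sub C m (y \<squnion>\<^bsub>Sub C X\<^esub> z))"
    using image_sub_mono[OF mA] preimage_sub_carrier[OF mA] N(1,3) m(2) by blast+
  then have "?N \<sqsubseteq>\<^bsub>Sub C X\<^esub> image_sub C m (preimage_sub C m (y \<squnion>\<^bsub>Sub C X\<^esub> z))" by simp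
  then show ?thesis
    using R R.le_trans[of ?N _ ?R] N image_sub_carrier[OF mA] preimage_sub_carrier[OF mA] m(2) by simp
qed

end

section \<open>Quasi-uniformities and their bases\<close>

lemma order_mapsD:
  assumes "U \<in> order_maps C X"
  shows "m \<in> carrier (Sub C X) \<Longrightarrow> U m \<in> carrier (Sub C X)"
    and "\<lbrakk>m \<sqsubseteq>\<^bsub>Sub C X\<^esub> n; m \<in> carrier (Sub C X); n \<in> carrier (Sub C X)\<rbrakk>
      \<Longrightarrow> U m \<sqsubseteq>\<^bsub>Sub C X\<^esub> U n"
  using assms by (auto simp: order_maps_def isotone_def)

lemma quasi_uniformity_baseD:
  assumes "quasi_uniformity_base C B"
  shows "\<lbrakk>X \<in> Obj C; U \<in> B X\<rbrakk> \<Longrightarrow> U \<in> order_maps C X"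
    and "\<lbrakk>X \<in> Obj C; U \<in> B X; m \<in> carrier (Sub C X)\<rbrakk> \<Longrightarrow> m \<sqsubseteq>\<^bsub>Sub C X\<^esub> U m"
    and "\<lbrakk>X \<in> Obj C; U \<in> B X\<rbrakk> \<Longrightarrow> \<exists>U' \<in> B X. map_le C X (U' \<circ> U') U"
    and "\<lbrakk>X \<in> Obj C; U \<in> B X; U' \<in> B X\<rbrakk> \<Longrightarrow> map_meet C X U U' \<in> B X"
    and "\<lbrakk>f \<in> Arr C; U \<in> B (Cod C f)\<rbrakk> \<Longrightarrow> \<exists>U' \<in> B (Dom C f). \<forall>m \<in> carrier (Sub C (Dom C f)).
      image_sub C f (U' m) \<sqsubseteq>\<^bsub>Sub C (Cod C f)\<^esub> U (image_sub C f m)"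
  using assms unfolding quasi_uniformity_base_def by blast+

section \<open>From a base to the generated quasi-uniformity\<close>

context M_complete_category
begin

lemma order_mapsI:
  assumes "U \<in> extensional (carrier (Sub C X))"
    and "\<And>m. m \<in> carrier (Sub C X) \<Longrightarrow> U m \<in> carrier (Sub C X)"
    and "\<And>m n. \<lbrakk>m \<sqsubseteq>\<^bsub>Sub C X\<^esub> n; m \<in> carrier (Sub C X); n \<in> carrier (Sub C X)\<rbrakk>
      \<Longrightarrow> U m \<sqsubseteq>\<^bsub>Sub C X\<^esub> U n"
  shows "U \<in> order_maps C X"
  using assms partial_order.axioms(1)[OF partial_order_Sub[of X]]
  by (simp add: order_maps_def isotone_def PiE_def Pi_def)

lemma map_le_refl: "U \<in> order_maps C X \<Longrightarrow> map_le C X U U"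
  using order_mapsD(1)[of U C X] Sub_refl by (simp add: map_le_def)

lemma map_le_trans:
  "\<lbrakk>map_le C X U V; map_le C X V W; U \<in> order_maps C X; V \<in> order_maps C X; W \<in> order_maps C X\<rbrakk>
    \<Longrightarrow> map_le C X U W"
  unfolding map_le_def using order_mapsD(1) Sub_trans by meson

lemma map_meet_order_maps:
  assumes X: "X \<in> Obj C" and U: "U \<in> order_maps C X" and V: "V \<in> order_maps C X"
  shows "map_meet C X U V \<in> order_maps C X"
proof -
  interpret lattice "Sub C X" using lattice_Sub[OF X] .
  show ?thesis
  proof (rule order_mapsI)
    fix m n
    assume mn: "m \<sqsubseteq>\<^bsub>Sub C X\<^esub> n" "m \<in> carrier (Sub C X)" "n \<in> carrier (Sub C X)"
    note c = order_mapsD(1)[OF U mn(2)] order_mapsD(1)[OF U mn(3)]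
      order_mapsD(1)[OF V mn(2)] order_mapsD(1)[OF V mn(3)]
    have "U m \<sqinter>\<^bsub>Sub C X\<^esub> V m \<sqsubseteq>\<^bsub>Sub C X\<^esub> U n"
      by (rule le_trans[OF meet_left order_mapsD(2)[OF U mn]]) (use c in simp_all)
    moreover have "U m \<sqinter>\<^bsub>Sub C X\<^esub> V m \<sqsubseteq>\<^bsub>Sub C X\<^esub> V n"
      by (rule le_trans[OF meet_right order_mapsD(2)[OF V mn]]) (use c in simp_all)
    ultimately show "map_meet C X U V m \<sqsubseteq>\<^bsub>Sub C X\<^esub> map_meet C X U V n"
      using mn c meet_le by (simp add: map_meet_def)
  qed (use order_mapsD(1)[OF U] order_mapsD(1)[OF V] in \<open>simp_all add: map_meet_def\<close>)
qed

text \<open>Each member lies above a base member, and the base axioms pass upward by transitivity;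
  for meets one also needs that \<open>map_meet\<close> is monotone in both arguments.\<close>

lemma quasi_uniformity_generated:
  assumes B: "quasi_uniformity_base C B"
  shows "quasi_uniformity C (generated C B)"
  unfolding quasi_uniformity_def quasi_uniformity_base_def
proof (intro conjI ballI impI)
  fix X assume "X \<in> Obj C"
  show "generated C B X \<subseteq> order_maps C X" by (auto simp: generated_def)
next
  fix X V m assume X: "X \<in> Obj C" and V: "V \<in> generated C B X" and m: "m \<in> carrier (Sub C X)"
  obtain U where U: "V \<in> order_maps C X" "U \<in> B X" "map_le C X U V"
    using V by (auto simp: generated_def)
  show "m \<sqsubseteq>\<^bsub>Sub C X\<^esub> V m"
    using quasi_uniformity_baseD(2)[OF B X U(2) m] U m order_mapsD(1)[OF U(1) m]
      order_mapsD(1)[OF quasi_uniformity_baseD(1)[OF B X U(2)] m] Sub_trans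
    unfolding map_le_def by blast
next
  fix X V assume X: "X \<in> Obj C" and V: "V \<in> generated C B X"
  obtain U where U: "V \<in> order_maps C X" "U \<in> B X" "map_le C X U V"
    using V by (auto simp: generated_def)
  obtain U' where U': "U' \<in> B X" "map_le C X (U' \<circ> U') U"
    using quasi_uniformity_baseD(3)[OF B X U(2)] by blast
  note o = quasi_uniformity_baseD(1)[OF B X]
  have "map_le C X (U' \<circ> U') V"
    unfolding map_le_def
  proof
    fix m assume m: "m \<in> carrier (Sub C X)"
    show "(U' \<circ> U') m \<sqsubseteq>\<^bsub>Sub C X\<^esub> V m"
      by (rule Sub_trans[of _ _ "U m"])
        (use m U(3) U'(2) order_mapsD(1)[OF o[OF U'(1)]] order_mapsD(1)[OF o[OF U(2)]]
          order_mapsD(1)[OF U(1)] in \<open>simp_all add: map_le_def\<close>)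
  qed
  moreover have "U' \<in> generated C B X"
    using U' o map_le_refl by (auto simp: generated_def)
  ultimately show "\<exists>U' \<in> generated C B X. map_le C X (U' \<circ> U') V" by blast
next
  fix X V V' assume X: "X \<in> Obj C" and V: "V \<in> generated C B X" and V': "V' \<in> generated C B X"
  interpret lattice "Sub C X" using lattice_Sub[OF X] .
  obtain U where U: "V \<in> order_maps C X" "U \<in> B X" "map_le C X U V"
    using V by (auto simp: generated_def)
  obtain U' where U': "V' \<in> order_maps C X" "U' \<in> B X" "map_le C X U' V'"
    using V' by (auto simp: generated_def)
  note o = quasi_uniformity_baseD(1)[OF B X U(2)] quasi_uniformity_baseD(1)[OF B X U'(2)]
  have "map_le C X (map_meet C X U U') (map_meet C X V V')"
    unfolding map_le_def
  proof
    fix m assume m: "m \<in> carrier (Sub C X)"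
    note c = order_mapsD(1)[OF o(1) m] order_mapsD(1)[OF o(2) m] order_mapsD(1)[OF U(1) m]
      order_mapsD(1)[OF U'(1) m]
    have "U m \<sqinter>\<^bsub>Sub C X\<^esub> U' m \<sqsubseteq>\<^bsub>Sub C X\<^esub> V m"
      by (rule le_trans[OF meet_left]) (use m c U(3) in \<open>simp_all add: map_le_def\<close>)
    moreover have "U m \<sqinter>\<^bsub>Sub C X\<^esub> U' m \<sqsubseteq>\<^bsub>Sub C X\<^esub> V' m"
      by (rule le_trans[OF meet_right]) (use m c U'(3) in \<open>simp_all add: map_le_def\<close>)
    ultimately show "map_meet C X U U' m \<sqsubseteq>\<^bsub>Sub C X\<^esub> map_meet C X V V' m"
      using m c meet_le by (simp add: map_meet_def)
  qed
  then show "map_meet C X V V' \<in> generated C B X"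
    using quasi_uniformity_baseD(4)[OF B X U(2) U'(2)] map_meet_order_maps[OF X U(1) U'(1)]
    unfolding generated_def by blast
next
  fix f V assume f: "f \<in> Arr C" and V: "V \<in> generated C B (Cod C f)"
  obtain U where U: "V \<in> order_maps C (Cod C f)" "U \<in> B (Cod C f)" "map_le C (Cod C f) U V"
    using V by (auto simp: generated_def)
  obtain U' where U': "U' \<in> B (Dom C f)" and le: "\<And>m. m \<in> carrier (Sub C (Dom C f)) \<Longrightarrow>
      image_sub C f (U' m) \<sqsubseteq>\<^bsub>Sub C (Cod C f)\<^esub> U (image_sub C f m)"
    using quasi_uniformity_baseD(5)[OF B f U(2)] by blast
  note o = quasi_uniformity_baseD(1)[OF B Cod_Obj[OF f] U(2)]
    quasi_uniformity_baseD(1)[OF B Dom_Obj[OF f] U']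
  have "image_sub C f (U' m) \<sqsubseteq>\<^bsub>Sub C (Cod C f)\<^esub> V (image_sub C f m)"
    if m: "m \<in> carrier (Sub C (Dom C f))" for m
    by (rule Sub_trans[OF le[OF m]])
      (use m f U(3) order_mapsD(1)[OF o(1)] order_mapsD(1)[OF o(2)] order_mapsD(1)[OF U(1)] in \<open>simp_all add: map_le_def\<close>)
  moreover have "U' \<in> generated C B (Dom C f)"
    using U' o map_le_refl by (auto simp: generated_def)
  ultimately show "\<exists>U' \<in> generated C B (Dom C f). \<forall>m \<in> carrier (Sub C (Dom C f)).
      image_sub C f (U' m) \<sqsubseteq>\<^bsub>Sub C (Cod C f)\<^esub> V (image_sub C f m)" by blast
next
  fix X V W assume X: "X \<in> Obj C" and V: "V \<in> generated C B X" and W: "W \<in> order_maps C X"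
    and le: "map_le C X V W"
  then show "W \<in> generated C B X"
    using map_le_trans[OF _ le] quasi_uniformity_baseD(1)[OF B X] unfolding generated_def by blast
qed

end

section \<open>The quasi-uniformity of a copointed endofunctor\<close>

locale M_copointed_category = M_complete_category C + M_copointed_endofunctor C Go Ga \<epsilon>
  for C :: "('o, 'a, 'z) fact_cat_scheme" (structure)
    and Go :: "'o \<Rightarrow> 'o" and Ga :: "'a \<Rightarrow> 'a" and \<epsilon> :: "'o \<Rightarrow> 'a" +
  assumes joins: "preimages_commute_with_joins C"
begin

section \<open>Images and preimages along the counit\<close>

lemma counit_simps [simp]:
  assumes "X \<in> Obj C"
  shows "\<epsilon> X \<in> Arr C" "Dom C (\<epsilon> X) = Go X" "Cod C (\<epsilon> X) = X"
  using counit_Hom[OF assms] by auto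

lemma counit_image_carrier [simp]:
  "\<lbrakk>X \<in> Obj C; K \<in> carrier (Sub C (Go X))\<rbrakk> \<Longrightarrow> image_sub C (\<epsilon> X) K \<in> carrier (Sub C X)"
  using image_sub_carrier[of "\<epsilon> X" K] by simp

lemma counit_preimage_carrier [simp]:
  "\<lbrakk>X \<in> Obj C; N \<in> carrier (Sub C X)\<rbrakk> \<Longrightarrow> preimage_sub C (\<epsilon> X) N \<in> carrier (Sub C (Go X))"
  using preimage_sub_carrier[of "\<epsilon> X" N] by simp

lemma counit_image_mono:
  "\<lbrakk>K \<sqsubseteq>\<^bsub>Sub C (Go X)\<^esub> L; X \<in> Obj C; K \<in> carrier (Sub C (Go X)); L \<in> carrier (Sub C (Go X))\<rbrakk>
    \<Longrightarrow> image_sub C (\<epsilon> X) K \<sqsubseteq>\<^bsub>Sub C X\<^esub> image_sub C (\<epsilon> X) L"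
  using image_sub_mono[of "\<epsilon> X" K L] by simp

lemma counit_preimage_mono:
  "\<lbrakk>K \<sqsubseteq>\<^bsub>Sub C X\<^esub> L; X \<in> Obj C; K \<in> carrier (Sub C X); L \<in> carrier (Sub C X)\<rbrakk>
    \<Longrightarrow> preimage_sub C (\<epsilon> X) K \<sqsubseteq>\<^bsub>Sub C (Go X)\<^esub> preimage_sub C (\<epsilon> X) L"
  using preimage_sub_mono[of "\<epsilon> X" K L] by simp

lemma counit_preimage_image:
  "\<lbrakk>X \<in> Obj C; K \<in> carrier (Sub C (Go X))\<rbrakk> \<Longrightarrow> preimage_sub C (\<epsilon> X) (image_sub C (\<epsilon> X) K) = K"
  using preimage_image_M[OF counit_M, of X K] by simp

section \<open>The map on subobjects of \<open>X\<close> induced by a map on subobjects of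
  \<open>Go X\<close>\<close>

context
  fixes X V
  assumes X: "X \<in> Obj C" and V: "V \<in> order_maps C (Go X)"
begin

interpretation lattice "Sub C X" using lattice_Sub[OF X] .

lemma copointed_map_carrier:
  "m \<in> carrier (Sub C X) \<Longrightarrow> copointed_map C \<epsilon> X V m \<in> carrier (Sub C X)"
  using X order_mapsD(1)[OF V] by (simp add: copointed_map_def)

lemma le_copointed_map:
  "m \<in> carrier (Sub C X) \<Longrightarrow> m \<sqsubseteq>\<^bsub>Sub C X\<^esub> copointed_map C \<epsilon> X V m"
  using X order_mapsD(1)[OF V] join_left by (simp add: copointed_map_def)

lemma image_le_copointed_map:
  "m \<in> carrier (Sub C X) \<Longrightarrow>
    image_sub C (\<epsilon> X) (V (preimage_sub C (\<epsilon> X) m)) \<sqsubseteq>\<^bsub>Sub C X\<^esub> copointed_map C \<epsilon> X V m"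
  using X order_mapsD(1)[OF V] join_right by (simp add: copointed_map_def)

lemma copointed_map_le:
  "\<lbrakk>m \<in> carrier (Sub C X); N \<in> carrier (Sub C X); m \<sqsubseteq>\<^bsub>Sub C X\<^esub> N;
    image_sub C (\<epsilon> X) (V (preimage_sub C (\<epsilon> X) m)) \<sqsubseteq>\<^bsub>Sub C X\<^esub> N\<rbrakk>
    \<Longrightarrow> copointed_map C \<epsilon> X V m \<sqsubseteq>\<^bsub>Sub C X\<^esub> N"
  using X order_mapsD(1)[OF V] join_le by (simp add: copointed_map_def)

lemma copointed_map_order_maps: "copointed_map C \<epsilon> X V \<in> order_maps C X"
proof (rule order_mapsI)
  fix m n
  assume mn: "m \<sqsubseteq>\<^bsub>Sub C X\<^esub> n" "m \<in> carrier (Sub C X)" "n \<in> carrier (Sub C X)"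
  let ?e = "\<lambda>m. image_sub C (\<epsilon> X) (V (preimage_sub C (\<epsilon> X) m))"
  note c = copointed_map_carrier[OF mn(2)] copointed_map_carrier[OF mn(3)]
  have "m \<sqsubseteq>\<^bsub>Sub C X\<^esub> copointed_map C \<epsilon> X V n"
    by (rule le_trans[OF mn(1) le_copointed_map[OF mn(3)]]) (use mn c in simp_all)
  moreover have "?e m \<sqsubseteq>\<^bsub>Sub C X\<^esub> ?e n"
    using mn X order_mapsD[OF V] counit_image_mono counit_preimage_mono by simp
  then have "?e m \<sqsubseteq>\<^bsub>Sub C X\<^esub> copointed_map C \<epsilon> X V n"
    by (rule le_trans[OF _ image_le_copointed_map[OF mn(3)]])
      (use mn c X order_mapsD(1)[OF V] in simp_all)
  ultimately show "copointed_map C \<epsilon> X V m \<sqsubseteq>\<^bsub>Sub C X\<^esub> copointed_map C \<epsilon> X V n"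
    using copointed_map_le mn c by simp
qed (use copointed_map_carrier in \<open>simp_all add: copointed_map_def\<close>)

text \<open>The preimage turns the defining join into \<open>?a \<squnion> V ?a\<close>, as it
  preserves joins and undoes the image along \<open>\<epsilon> X\<close>; the join is
  \<open>V ?a\<close> because \<open>V\<close> is inflationary. This makes iterates of such maps
  computable.\<close>

lemma preimage_copointed_map:
  assumes ext: "\<And>a. a \<in> carrier (Sub C (Go X)) \<Longrightarrow> a \<sqsubseteq>\<^bsub>Sub C (Go X)\<^esub> V a"
    and m: "m \<in> carrier (Sub C X)"
  shows "preimage_sub C (\<epsilon> X) (copointed_map C \<epsilon> X V m) = V (preimage_sub C (\<epsilon> X) m)"
proof -
  interpret G: lattice "Sub C (Go X)" using lattice_Sub functor_Obj X by simp
  let ?a = "preimage_sub C (\<epsilon> X) m"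
  have a: "?a \<in> carrier (Sub C (Go X))" "V ?a \<in> carrier (Sub C (Go X))"
    using X m order_mapsD(1)[OF V] by simp_all
  have "preimage_sub C (\<epsilon> X) (copointed_map C \<epsilon> X V m) = ?a \<squnion>\<^bsub>Sub C (Go X)\<^esub> V ?a"
    using preimage_join[OF joins, of "\<epsilon> X" m "image_sub C (\<epsilon> X) (V ?a)"] X m a
      counit_preimage_image by (simp add: copointed_map_def)
  also have "\<dots> = V ?a"
    using ext[OF a(1)] a G.join_le[OF _ _ a] G.join_right[OF a]
    by (intro G.le_antisym) simp_all
  finally show ?thesis .
qed

end

text \<open>A base must contain the meet itself, so an equality is required. One inequality rests on
  distributivity and on images along \<open>\<epsilon> X\<close> preserving meets, the other on
  monotonicity.\<close>

lemma map_meet_copointed_map: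
  assumes X: "X \<in> Obj C" and V: "V \<in> order_maps C (Go X)" and W: "W \<in> order_maps C (Go X)"
  shows "map_meet C X (copointed_map C \<epsilon> X V) (copointed_map C \<epsilon> X W) =
    copointed_map C \<epsilon> X (map_meet C (Go X) V W)"
\<comment> \<open>Both maps are restricted to the carrier, so agreement there is equality of
  functions.\<close>
proof (rule extensionalityI[of _ "carrier (Sub C X)"])
  have GX: "Go X \<in> Obj C" using functor_Obj X by simp
  interpret lattice "Sub C X" using lattice_Sub X by simp
  interpret G: lattice "Sub C (Go X)" using lattice_Sub GX by simp
  fix m assume m: "m \<in> carrier (Sub C X)"
  let ?a = "preimage_sub C (\<epsilon> X) m"
  let ?v = "image_sub C (\<epsilon> X) (V ?a)" and ?w = "image_sub C (\<epsilon> X) (W ?a)"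
  let ?vw = "image_sub C (\<epsilon> X) (V ?a \<sqinter>\<^bsub>Sub C (Go X)\<^esub> W ?a)"
  have a: "?a \<in> carrier (Sub C (Go X))" "V ?a \<in> carrier (Sub C (Go X))"
    "W ?a \<in> carrier (Sub C (Go X))"
    using X m order_mapsD(1)[OF V] order_mapsD(1)[OF W] by simp_all
  have c: "?v \<in> carrier (Sub C X)" "?w \<in> carrier (Sub C X)" "?vw \<in> carrier (Sub C X)"
    using X a by simp_all
  have "(m \<squnion>\<^bsub>Sub C X\<^esub> ?v) \<sqinter>\<^bsub>Sub C X\<^esub> (m \<squnion>\<^bsub>Sub C X\<^esub> ?w) \<sqsubseteq>\<^bsub>Sub C X\<^esub>
      m \<squnion>\<^bsub>Sub C X\<^esub> (?v \<sqinter>\<^bsub>Sub C X\<^esub> ?w)"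
    by (rule dual_distrib_le[OF Sub_distrib_le[OF joins X]]) (use m c in simp_all)
  moreover have "?v \<sqinter>\<^bsub>Sub C X\<^esub> ?w \<sqsubseteq>\<^bsub>Sub C X\<^esub> ?vw"
    using image_meet_M[OF counit_M, of X "V ?a" "W ?a"] X a by simp
  then have "?v \<sqinter>\<^bsub>Sub C X\<^esub> ?w \<sqsubseteq>\<^bsub>Sub C X\<^esub> m \<squnion>\<^bsub>Sub C X\<^esub> ?vw"
    by (rule le_trans[OF _ join_right]) (use m c in simp_all)
  then have "m \<squnion>\<^bsub>Sub C X\<^esub> (?v \<sqinter>\<^bsub>Sub C X\<^esub> ?w) \<sqsubseteq>\<^bsub>Sub C X\<^esub> m \<squnion>\<^bsub>Sub C X\<^esub> ?vw"
    using m c join_left by (intro join_le) simp_all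
  ultimately have 1: "(m \<squnion>\<^bsub>Sub C X\<^esub> ?v) \<sqinter>\<^bsub>Sub C X\<^esub> (m \<squnion>\<^bsub>Sub C X\<^esub> ?w)
      \<sqsubseteq>\<^bsub>Sub C X\<^esub> m \<squnion>\<^bsub>Sub C X\<^esub> ?vw"
    by (rule le_trans) (use m c in simp_all)
  have "?vw \<sqsubseteq>\<^bsub>Sub C X\<^esub> ?v" "?vw \<sqsubseteq>\<^bsub>Sub C X\<^esub> ?w"
    using X a G.meet_left G.meet_right by (simp_all add: counit_image_mono)
  then have "?vw \<sqsubseteq>\<^bsub>Sub C X\<^esub> m \<squnion>\<^bsub>Sub C X\<^esub> ?v" "?vw \<sqsubseteq>\<^bsub>Sub C X\<^esub> m \<squnion>\<^bsub>Sub C X\<^esub> ?w"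
    using le_trans[OF _ join_right] m c by simp_all
  then have "m \<squnion>\<^bsub>Sub C X\<^esub> ?vw \<sqsubseteq>\<^bsub>Sub C X\<^esub>
      (m \<squnion>\<^bsub>Sub C X\<^esub> ?v) \<sqinter>\<^bsub>Sub C X\<^esub> (m \<squnion>\<^bsub>Sub C X\<^esub> ?w)"
    using m c by (intro meet_le join_le join_left) simp_all
  with 1 have "(m \<squnion>\<^bsub>Sub C X\<^esub> ?v) \<sqinter>\<^bsub>Sub C X\<^esub> (m \<squnion>\<^bsub>Sub C X\<^esub> ?w) = m \<squnion>\<^bsub>Sub C X\<^esub> ?vw"
    by (rule le_antisym) (use m c in simp_all)
  then show "map_meet C X (copointed_map C \<epsilon> X V) (copointed_map C \<epsilon> X W) m =
      copointed_map C \<epsilon> X (map_meet C (Go X) V W) m"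
    using m a by (simp add: map_meet_def copointed_map_def)
qed (simp_all add: map_meet_def copointed_map_def)

text \<open>Both sides are the preimage of \<open>N\<close> along the common diagonal of the
  naturality square of \<open>\<epsilon>\<close> at \<open>f\<close>.\<close>

lemma counit_preimage_natural:
  assumes f: "f \<in> Arr C" and N: "N \<in> carrier (Sub C (Cod C f))"
  shows "preimage_sub C (\<epsilon> (Dom C f)) (preimage_sub C f N) =
    preimage_sub C (Ga f) (preimage_sub C (\<epsilon> (Cod C f)) N)"
proof -
  have o: "Dom C f \<in> Obj C" "Cod C f \<in> Obj C" using f Dom_Obj Cod_Obj by auto
  show ?thesis
    using preimage_sub_Comp[of "\<epsilon> (Dom C f)" f N] preimage_sub_Comp[of "Ga f" "\<epsilon> (Cod C f)" N]
      f N o functor_Arr[OF f] counit_natural[OF f] by simp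
qed

text \<open>(U1) is due to the joinand \<open>m\<close>. (U2) and (U4) are carried over from
  \<open>B\<close> at \<open>Go X\<close>, and (U5) for \<open>f\<close> from (U5) for
  \<open>Ga f\<close>.\<close>

lemma quasi_uniformity_base_copointed:
  assumes B: "quasi_uniformity_base C B"
  shows "quasi_uniformity_base C (\<lambda>X. copointed_map C \<epsilon> X ` B (Go X))"
  unfolding quasi_uniformity_base_def
proof (intro conjI ballI)
  fix X assume X: "X \<in> Obj C"
  show "copointed_map C \<epsilon> X ` B (Go X) \<subseteq> order_maps C X"
    using X functor_Obj quasi_uniformity_baseD(1)[OF B] copointed_map_order_maps by blast
next
  fix X U m assume X: "X \<in> Obj C" "U \<in> copointed_map C \<epsilon> X ` B (Go X)" "m \<in> carrier (Sub C X)"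
  then show "m \<sqsubseteq>\<^bsub>Sub C X\<^esub> U m"
    using functor_Obj quasi_uniformity_baseD(1)[OF B] le_copointed_map by blast
next
  fix X U assume X: "X \<in> Obj C" and "U \<in> copointed_map C \<epsilon> X ` B (Go X)"
  then obtain V where V: "V \<in> B (Go X)" "U = copointed_map C \<epsilon> X V" by blast
  have GX: "Go X \<in> Obj C" using functor_Obj X by simp
  obtain W where W: "W \<in> B (Go X)" "map_le C (Go X) (W \<circ> W) V"
    using quasi_uniformity_baseD(3)[OF B GX V(1)] by blast
  note oV = quasi_uniformity_baseD(1)[OF B GX V(1)] and oW = quasi_uniformity_baseD(1)[OF B GX W(1)]
  note ext = quasi_uniformity_baseD(2)[OF B GX W(1)]
  interpret lattice "Sub C X" using lattice_Sub X by simp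
  have "copointed_map C \<epsilon> X W (copointed_map C \<epsilon> X W m) \<sqsubseteq>\<^bsub>Sub C X\<^esub> copointed_map C \<epsilon> X V m"
    if m: "m \<in> carrier (Sub C X)" for m
  proof -
    let ?a = "preimage_sub C (\<epsilon> X) m" and ?R = "copointed_map C \<epsilon> X V m"
    let ?k = "copointed_map C \<epsilon> X W m"
    note R = copointed_map_carrier[OF X oV m] and k = copointed_map_carrier[OF X oW m]
    have a: "?a \<in> carrier (Sub C (Go X))" "V ?a \<in> carrier (Sub C (Go X))"
      "W ?a \<in> carrier (Sub C (Go X))" "W (W ?a) \<in> carrier (Sub C (Go X))"
      using X m order_mapsD(1)[OF oV] order_mapsD(1)[OF oW] by simp_all
    have WW: "W (W ?a) \<sqsubseteq>\<^bsub>Sub C (Go X)\<^esub> V ?a"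
      using W(2) a by (simp add: map_le_def)
    \<comment> \<open>Since \<open>W\<close> is inflationary, \<open>W ?a\<close> is below
      \<open>W (W ?a)\<close>.\<close>
    then have Wle: "W ?a \<sqsubseteq>\<^bsub>Sub C (Go X)\<^esub> V ?a"
      by (rule Sub_trans[OF ext[OF a(3)]]) (use a in simp_all)
    have le: "image_sub C (\<epsilon> X) b \<sqsubseteq>\<^bsub>Sub C X\<^esub> ?R"
      if "b \<in> carrier (Sub C (Go X))" "b \<sqsubseteq>\<^bsub>Sub C (Go X)\<^esub> V ?a" for b
      by (rule le_trans[OF counit_image_mono[OF that(2) X] image_le_copointed_map[OF X oV m]])
        (use X a that R in simp_all)
    have "?k \<sqsubseteq>\<^bsub>Sub C X\<^esub> ?R"
      using copointed_map_le[OF X oW m R le_copointed_map[OF X oV m]] le Wle a by simp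
    \<comment> \<open>The preimage of \<open>?k\<close> is \<open>W ?a\<close>, so the second
      application contributes only \<open>?k\<close> and the image of
      \<open>W (W ?a)\<close>.\<close>
    then show ?thesis
      using copointed_map_le[OF X oW k R] preimage_copointed_map[OF X oW ext m] le WW a by simp
  qed
  then have "map_le C X (copointed_map C \<epsilon> X W \<circ> copointed_map C \<epsilon> X W) U"
    using V by (simp add: map_le_def)
  then show "\<exists>U' \<in> copointed_map C \<epsilon> X ` B (Go X). map_le C X (U' \<circ> U') U"
    using W(1) by blast
next
  fix X U U'
  assume X: "X \<in> Obj C" and "U \<in> copointed_map C \<epsilon> X ` B (Go X)"
    "U' \<in> copointed_map C \<epsilon> X ` B (Go X)"
  then show "map_meet C X U U' \<in> copointed_map C \<epsilon> X ` B (Go X)"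
    using functor_Obj[OF X] quasi_uniformity_baseD(1,4)[OF B] map_meet_copointed_map[OF X]
    by (auto intro!: imageI)
next
  fix f U assume f: "f \<in> Arr C" and U: "U \<in> copointed_map C \<epsilon> (Cod C f) ` B (Go (Cod C f))"
  let ?X = "Dom C f" and ?Y = "Cod C f"
  have X: "?X \<in> Obj C" "Go ?X \<in> Obj C" and Y: "?Y \<in> Obj C" "Go ?Y \<in> Obj C"
    using f Dom_Obj Cod_Obj functor_Obj by auto
  have Gf: "Ga f \<in> Arr C" "Dom C (Ga f) = Go ?X" "Cod C (Ga f) = Go ?Y"
    using functor_Arr[OF f] by auto
  obtain V where V: "V \<in> B (Go ?Y)" "U = copointed_map C \<epsilon> ?Y V" using U by blast
  \<comment> \<open>(U5) is applied to \<open>Ga f\<close>, an arrow from \<open>Go ?X\<close> to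
    \<open>Go ?Y\<close>.\<close>
  obtain W where W: "W \<in> B (Go ?X)" and le: "\<And>m. m \<in> carrier (Sub C (Go ?X)) \<Longrightarrow>
      image_sub C (Ga f) (W m) \<sqsubseteq>\<^bsub>Sub C (Go ?Y)\<^esub> V (image_sub C (Ga f) m)"
    using quasi_uniformity_baseD(5)[OF B Gf(1), of V, unfolded Gf(2,3)] V(1) by blast
  note oV = quasi_uniformity_baseD(1)[OF B Y(2) V(1)] and oW = quasi_uniformity_baseD(1)[OF B X(2) W]
  have "image_sub C f (copointed_map C \<epsilon> ?X W m) \<sqsubseteq>\<^bsub>Sub C ?Y\<^esub> U (image_sub C f m)"
    if m: "m \<in> carrier (Sub C ?X)" for m
  proof -
    let ?fm = "image_sub C f m" and ?a = "preimage_sub C (\<epsilon> ?X) m"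
    let ?R = "copointed_map C \<epsilon> ?Y V ?fm"
    let ?b = "preimage_sub C (\<epsilon> ?Y) ?fm" and ?S = "preimage_sub C (\<epsilon> ?Y) ?R"
    have fm: "?fm \<in> carrier (Sub C ?Y)" using f m by simp
    note R = copointed_map_carrier[OF Y(1) oV fm]
    have c: "?a \<in> carrier (Sub C (Go ?X))" "W ?a \<in> carrier (Sub C (Go ?X))"
      "?b \<in> carrier (Sub C (Go ?Y))" "V ?b \<in> carrier (Sub C (Go ?Y))" "?S \<in> carrier (Sub C (Go ?Y))"
      "image_sub C (Ga f) ?a \<in> carrier (Sub C (Go ?Y))"
      "image_sub C (Ga f) (W ?a) \<in> carrier (Sub C (Go ?Y))"
      "V (image_sub C (Ga f) ?a) \<in> carrier (Sub C (Go ?Y))"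
      "preimage_sub C f ?R \<in> carrier (Sub C ?X)"
      using X Y m fm R f Gf order_mapsD(1)[OF oV] order_mapsD(1)[OF oW]
        image_sub_carrier[OF Gf(1)] by simp_all
    \<comment> \<open>By adjunction it suffices to put the new map at \<open>m\<close> below the
      preimage of \<open>?R\<close> along \<open>f\<close>. The joinand \<open>W ?a\<close> is
      followed across the naturality square: first to \<open>Go ?Y\<close>, where \<open>V\<close>
      acts, and then back.\<close>
    have "?a \<sqsubseteq>\<^bsub>Sub C (Go ?X)\<^esub> preimage_sub C (\<epsilon> ?X) (preimage_sub C f ?fm)"
      using counit_preimage_mono[OF le_preimage_image[OF f m]] X f m fm by simp
    then have "?a \<sqsubseteq>\<^bsub>Sub C (Go ?X)\<^esub> preimage_sub C (Ga f) ?b"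
      using counit_preimage_natural[OF f fm] by simp
    then have "image_sub C (Ga f) ?a \<sqsubseteq>\<^bsub>Sub C (Go ?Y)\<^esub> ?b"
      using image_preimage_adjoint[OF Gf(1), of ?b ?a] Gf c by simp
    then have 1: "V (image_sub C (Ga f) ?a) \<sqsubseteq>\<^bsub>Sub C (Go ?Y)\<^esub> V ?b"
      using order_mapsD(2)[OF oV] c by simp
    have "V ?b \<sqsubseteq>\<^bsub>Sub C (Go ?Y)\<^esub> ?S"
      using image_preimage_adjoint[of "\<epsilon> ?Y" ?R "V ?b"] image_le_copointed_map[OF Y(1) oV fm] Y R c
      by simp
    then have "V (image_sub C (Ga f) ?a) \<sqsubseteq>\<^bsub>Sub C (Go ?Y)\<^esub> ?S"
      by (rule Sub_trans[OF 1]) (use c in simp_all)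
    then have "image_sub C (Ga f) (W ?a) \<sqsubseteq>\<^bsub>Sub C (Go ?Y)\<^esub> ?S"
      by (rule Sub_trans[OF le[OF c(1)]]) (use c in simp_all)
    then have "W ?a \<sqsubseteq>\<^bsub>Sub C (Go ?X)\<^esub> preimage_sub C (Ga f) ?S"
      using image_preimage_adjoint[OF Gf(1), of ?S "W ?a"] Gf c by simp
    \<comment> \<open>Naturality exchanges the route through \<open>Go ?Y\<close> for the one
      through \<open>?X\<close>.\<close>
    then have "W ?a \<sqsubseteq>\<^bsub>Sub C (Go ?X)\<^esub> preimage_sub C (\<epsilon> ?X) (preimage_sub C f ?R)"
      using counit_preimage_natural[OF f R] by simp
    then have "image_sub C (\<epsilon> ?X) (W ?a) \<sqsubseteq>\<^bsub>Sub C ?X\<^esub> preimage_sub C f ?R"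
      using image_preimage_adjoint[of "\<epsilon> ?X" "preimage_sub C f ?R" "W ?a"] X c by simp
    moreover have "m \<sqsubseteq>\<^bsub>Sub C ?X\<^esub> preimage_sub C f ?R"
      using image_preimage_adjoint[OF f R m] le_copointed_map[OF Y(1) oV fm] by simp
    ultimately have "copointed_map C \<epsilon> ?X W m \<sqsubseteq>\<^bsub>Sub C ?X\<^esub> preimage_sub C f ?R"
      using copointed_map_le[OF X(1) oW m] c by simp
    then show ?thesis
      using image_preimage_adjoint[OF f R] copointed_map_carrier[OF X(1) oW m] V(2) by simp
  qed
  then show "\<exists>U' \<in> copointed_map C \<epsilon> ?X ` B (Go ?X). \<forall>m \<in> carrier (Sub C ?X).
      image_sub C f (U' m) \<sqsubseteq>\<^bsub>Sub C ?Y\<^esub> U (image_sub C f m)"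
    using W by blast
qed

text \<open>The \<open>V\<close> whose induced map lies below \<open>U\<close> is itself the
  witness, because the preimage of the image of \<open>m\<close> along \<open>\<epsilon> X\<close>
  is \<open>m\<close>.\<close>

lemma continuous_counit_generated:
  assumes B: "quasi_uniformity_base C B" and X: "X \<in> Obj C"
  shows "continuous_arr C (generated C B) (generated C (\<lambda>X. copointed_map C \<epsilon> X ` B (Go X))) (\<epsilon> X)"
  unfolding continuous_arr_def
proof (rule ballI, unfold counit_simps[OF X])
  have GX: "Go X \<in> Obj C" using functor_Obj X by simp
  fix U assume "U \<in> generated C (\<lambda>X. copointed_map C \<epsilon> X ` B (Go X)) X"
  then obtain V where U: "U \<in> order_maps C X" and V: "V \<in> B (Go X)"
    and le: "map_le C X (copointed_map C \<epsilon> X V) U"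
    by (auto simp: generated_def)
  note oV = quasi_uniformity_baseD(1)[OF B GX V]
  have "image_sub C (\<epsilon> X) (V m) \<sqsubseteq>\<^bsub>Sub C X\<^esub> U (image_sub C (\<epsilon> X) m)"
    if m: "m \<in> carrier (Sub C (Go X))" for m
  proof -
    have em: "image_sub C (\<epsilon> X) m \<in> carrier (Sub C X)" using X m by simp
    have "image_sub C (\<epsilon> X) (V m) \<sqsubseteq>\<^bsub>Sub C X\<^esub> copointed_map C \<epsilon> X V (image_sub C (\<epsilon> X) m)"
      using image_le_copointed_map[OF X oV em] counit_preimage_image[OF X m] by simp
    then show ?thesis
      by (rule Sub_trans) (use le em X m order_mapsD(1)[OF U] order_mapsD(1)[OF oV] copointed_map_carrier[OF X oV] in
        \<open>simp_all add: map_le_def\<close>)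
  qed
  moreover have "V \<in> generated C B (Go X)"
    using V oV map_le_refl by (auto simp: generated_def)
  ultimately show "\<exists>V \<in> generated C B (Go X). \<forall>m \<in> carrier (Sub C (Go X)).
      image_sub C (\<epsilon> X) (V m) \<sqsubseteq>\<^bsub>Sub C X\<^esub> U (image_sub C (\<epsilon> X) m)" by blast
qed

text \<open>Continuity is evaluated at the preimage \<open>?a\<close> of \<open>m\<close>. It bounds
  the joinand coming from \<open>V\<close> by \<open>U m\<close>, and the joinand \<open>m\<close>
  is below \<open>U m\<close> because \<open>U\<close> is inflationary.\<close>

lemma coarser_eq_generated_copointed:
  assumes B: "quasi_uniformity_base C B" and W: "quasi_uniformity C \<W>"
    and cont: "\<And>X. X \<in> Obj C \<Longrightarrow> continuous_arr C (generated C B) \<W> (\<epsilon> X)"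
  shows "coarser_eq C \<W> (generated C (\<lambda>X. copointed_map C \<epsilon> X ` B (Go X)))"
  unfolding coarser_eq_def
proof (intro ballI)
  fix X U assume X: "X \<in> Obj C" and U: "U \<in> \<W> X"
  have GX: "Go X \<in> Obj C" using functor_Obj X by simp
  have Wb: "quasi_uniformity_base C \<W>" using W by (simp add: quasi_uniformity_def)
  note oU = quasi_uniformity_baseD(1)[OF Wb X U]
  obtain V' where V': "V' \<in> generated C B (Go X)"
    and le: "\<And>m. m \<in> carrier (Sub C (Go X)) \<Longrightarrow>
      image_sub C (\<epsilon> X) (V' m) \<sqsubseteq>\<^bsub>Sub C X\<^esub> U (image_sub C (\<epsilon> X) m)"
    using cont[OF X] U unfolding continuous_arr_def counit_simps[OF X] by blast
  then obtain V where oV': "V' \<in> order_maps C (Go X)" and V: "V \<in> B (Go X)"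
    and VV': "map_le C (Go X) V V'"
    by (auto simp: generated_def)
  note oV = quasi_uniformity_baseD(1)[OF B GX V]
  have "copointed_map C \<epsilon> X V m \<sqsubseteq>\<^bsub>Sub C X\<^esub> U m" if m: "m \<in> carrier (Sub C X)" for m
  proof -
    let ?a = "preimage_sub C (\<epsilon> X) m"
    have a: "?a \<in> carrier (Sub C (Go X))" "V ?a \<in> carrier (Sub C (Go X))"
      "V' ?a \<in> carrier (Sub C (Go X))" "U m \<in> carrier (Sub C X)"
      "U (image_sub C (\<epsilon> X) ?a) \<in> carrier (Sub C X)"
      using X m order_mapsD(1)[OF oV] order_mapsD(1)[OF oV'] order_mapsD(1)[OF oU] by simp_all
    \<comment> \<open>Continuity bounds by \<open>U\<close> at the image of \<open>?a\<close>; this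
      image is only below \<open>m\<close>, so monotonicity of \<open>U\<close> is used to reach
      \<open>U m\<close>.\<close>
    have "image_sub C (\<epsilon> X) ?a \<sqsubseteq>\<^bsub>Sub C X\<^esub> m"
      using image_preimage_le[of "\<epsilon> X" m] X m by simp
    then have "U (image_sub C (\<epsilon> X) ?a) \<sqsubseteq>\<^bsub>Sub C X\<^esub> U m"
      using order_mapsD(2)[OF oU] X m a by simp
    then have "image_sub C (\<epsilon> X) (V' ?a) \<sqsubseteq>\<^bsub>Sub C X\<^esub> U m"
      by (rule Sub_trans[OF le[OF a(1)]]) (use X a in simp_all)
    moreover have "V ?a \<sqsubseteq>\<^bsub>Sub C (Go X)\<^esub> V' ?a" using VV' a by (simp add: map_le_def)
    ultimately have "image_sub C (\<epsilon> X) (V ?a) \<sqsubseteq>\<^bsub>Sub C X\<^esub> U m"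
      using Sub_trans[OF counit_image_mono] X a by simp
    then show ?thesis
      using copointed_map_le[OF X oV m a(4)] quasi_uniformity_baseD(2)[OF Wb X U m] by simp
  qed
  then have "map_le C X (copointed_map C \<epsilon> X V) U" by (simp add: map_le_def)
  moreover have "copointed_map C \<epsilon> X V \<in> generated C (\<lambda>X. copointed_map C \<epsilon> X ` B (Go X)) X"
    using V map_le_refl copointed_map_order_maps[OF X oV] by (auto simp: generated_def)
  ultimately show "\<exists>V \<in> generated C (\<lambda>X. copointed_map C \<epsilon> X ` B (Go X)) X. map_le C X V U"
    by blast
qed

end

theorem proposition7:
  fixes C :: "('o, 'a, 'z) fact_cat_scheme"
    and Go :: "'o \<Rightarrow> 'o" and Ga :: "'a \<Rightarrow> 'a" and \<epsilon> :: "'o \<Rightarrow> 'a"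
    and S :: "'o \<Rightarrow> ('a set \<times> 'a set) set set"
  assumes "M_complete_category C"
    and "preimages_commute_with_joins C"
    and "M_copointed_endofunctor C Go Ga \<epsilon>"
    and "syntopogenous C S" and "co_perfect C S"
    and "quasi_uniformity_base C (synto_base C S)"
  shows "base_for C (copointed_base C Go \<epsilon> S) (generated C (copointed_base C Go \<epsilon> S)) \<and>
    finest_such_that C
      (\<lambda>\<W>. \<forall>X \<in> Obj C. continuous_arr C (generated C (synto_base C S)) \<W> (\<epsilon> X))
      (generated C (copointed_base C Go \<epsilon> S))"
proof -
  interpret M_copointed_category C Go Ga \<epsilon>
    by (intro M_copointed_category.intro M_copointed_category_axioms.intro assms)
  note B = assms(6)
  have eq: "copointed_base C Go \<epsilon> S = (\<lambda>X. copointed_map C \<epsilon> X ` synto_base C S (Go X))"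
    by (rule ext) (simp add: copointed_base_def)
  have "quasi_uniformity_base C (copointed_base C Go \<epsilon> S)"
    using quasi_uniformity_base_copointed[OF B] eq by simp
  then show ?thesis
    using quasi_uniformity_generated continuous_counit_generated[OF B]
      coarser_eq_generated_copointed[OF B] eq
    by (simp add: base_for_def finest_such_that_def)
qed

end
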